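(* Let $\Phi=\Phi_M+\Phi_G$ be the Poisson$+$Grid point process, let the fading variable $F$ be exponentially distributed with mean $1/\mu$, and let the path-loss function be $l(r)=(Ar)^\beta$ with $A>0$ and $\beta>2$. Suppose that $W$ is constant and strictly positive. Then, for every unit vector $\mathrm{d}\in\mathbb{R}^2$, $\mathbf{E}[\kappa_{\mathrm{d}}]>0$, where $\kappa_{\mathrm{d}}=\lim_{t\to\infty}p(0,t\mathrm{d},\Phi)/t$ (limit $\mathbf{P}$-a.s. and in $L_1$).
   Context: Poisson$+$Grid process: $\Phi=\Phi_M+\Phi_G$ is the superposition of two independent point processes on $\mathbb{R}^2$, where $\Phi_M$ is a stationary Poisson process with finite positive intensity $\lambda_M$ and $\Phi_G=s\mathbb{Z}^2+U_G$, $s>0$, is a square grid randomly shifted by $U_G$ uniformly distributed in $[0,s]^2$. Marks. The points $X_i$ of $\Phi$ carry random marks: medium access indicators $e_i(n)$, $n\in\mathbb{Z}$, i.i.d. in $i$ and $n$, Bernoulli with $\mathbf{P}\{e=1\}=p=1-\mathbf{P}\{e=0\}$, $0<p<1$; noise powers $W_i(n)\ge 0$, i.i.d. in $i,n$, distributed as $W$; fadings $F_{i,j}(n)\ge 0$, i.i.d. in $i,j,n$, distributed as $F$. Given $\Phi$, the three families are independent, with these laws. $l$ is the path-loss function and $T>0$ is a fixed threshold. Let $I_{i,j}(n)=\sum_{k\ne i:\,e_k(n)=1}F_{k,j}(n)/l(|X_k-X_j|)$ and, when $e_i(n)=1$, $e_j(n)=0$, $\mathrm{SINR}_{i,j}(n)=\dfrac{F_{i,j}(n)/l(|X_i-X_j|)}{W_j(n)+I_{i,j}(n)}$.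 Put $\delta_{i,j}(n)=\mathbf{1}(\mathrm{SINR}_{i,j}(n)\ge T)$ if $i\ne j$, $e_i(n)=1$, $e_j(n)=0$; $\delta_{i,i}(n)=1$; and $\delta_{i,j}(n)=0$ otherwise. The space-time SINR graph $\mathbb{G}$ is the directed graph with vertex set $\Phi\times\mathbb{Z}$ and a directed edge from $(X_i,n)$ to $(X_j,n+1)$ whenever $\delta_{i,j}(n)=1$. For $x\in\mathbb{R}^2$, $X(x)$ is the (a.s. unique) point of $\Phi$ closest to $x$. For $x,y\in\mathbb{R}^2$, $P(x,y,n)$ is the length (number of edges) of a shortest directed path of $\mathbb{G}$ from $(X(x),n)$ to the set $\{(X(y),n+l):l\in\{1,2,\ldots\}\}$, and $p(x,y,\Phi)=\mathbf{E}[P(x,y,0)\mid\Phi]$. Under the stated assumptions on $\Phi$, $F$ and $l$, the limit $\kappa_{\mathrm{d}}$ exists $\mathbf{P}$-a.s. and in $L_1$, and is a.s. finite and non-negative. *)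

theory Defs
  imports "HOL-Probability.Probability"
begin

section \<open>Point processes in the plane\<close>

text \<open>
  A point process is given by its points: a countable family of random vectors
  \<open>X :: 'i \<Rightarrow> 'w \<Rightarrow> real^2\<close>. The random measure it stands for is \<open>B \<mapsto> pt_count (X \<cdot> \<omega>) B\<close>,
  counted with multiplicity and with values in \<open>[0, \<infinity>]\<close>.
\<close>

definition pt_count :: "('i \<Rightarrow> real^2) \<Rightarrow> (real^2) set \<Rightarrow> ennreal" where
  "pt_count X B = emeasure (count_space UNIV) {i. X i \<in> B}"

text \<open>
  The sigma-algebra generated by the point process, i.e. by its counts; it does not see
  how the points are enumerated.
\<close>

definition pp_sigma :: "'w measure \<Rightarrow> ('i \<Rightarrow> 'w \<Rightarrow> real^2) \<Rightarrow> 'w measure" where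
  "pp_sigma M X = sigma (space M)
     {(\<lambda>\<omega>. pt_count (\<lambda>i. X i \<omega>) B) -` C \<inter> space M | B C. B \<in> sets borel \<and> C \<in> sets borel}"

text \<open>
  The law of the counts is spelled out because \<open>poisson_pmf\<close> is restricted to positive rates,
  while Lebesgue-null \<open>B\<close> have rate 0. The probabilities sum to 1, so bounded sets
  almost surely contain finitely many points.
\<close>

definition stationary_poisson_process ::
    "'w measure \<Rightarrow> real \<Rightarrow> ('i \<Rightarrow> 'w \<Rightarrow> real^2) \<Rightarrow> bool" where
  "stationary_poisson_process M lam X \<longleftrightarrow>
     (\<forall>i. X i \<in> borel_measurable M) \<and>
     (\<forall>B k. B \<in> sets borel \<longrightarrow> bounded B \<longrightarrow>
        measure M {\<omega> \<in> space M. pt_count (\<lambda>i. X i \<omega>) B = of_nat k} =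
          (lam * measure lborel B) ^ k / fact k * exp (- (lam * measure lborel B))) \<and>
     (\<forall>(B :: nat \<Rightarrow> (real^2) set) m.
        (\<forall>k<m. B k \<in> sets borel \<and> bounded (B k)) \<longrightarrow> disjoint_family_on B {..<m} \<longrightarrow>
        prob_space.indep_vars M (\<lambda>_. borel) (\<lambda>k \<omega>. pt_count (\<lambda>i. X i \<omega>) (B k)) {..<m})"

type_synonym pidx = "nat + int \<times> int"

text \<open>
  The superposition of the points \<open>XM 0, XM 1, \<dots>\<close> (the Poisson part) and the
  shifted grid with points \<open>U + s (a, b)\<close>.
\<close>

definition poisson_grid ::
    "real \<Rightarrow> (nat \<Rightarrow> 'w \<Rightarrow> real^2) \<Rightarrow> ('w \<Rightarrow> real^2) \<Rightarrow> pidx \<Rightarrow> 'w \<Rightarrow> real^2" where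
  "poisson_grid s XM U i \<omega> =
     (case i of Inl k \<Rightarrow> XM k \<omega>
      | Inr (a, b) \<Rightarrow> U \<omega> + s *\<^sub>R vector [real_of_int a, real_of_int b])"

section \<open>The marked Poisson+Grid process\<close>

datatype source =
  Poisson_points | Grid_shift | Access pidx int | Noise pidx int | Fading pidx pidx int

text \<open>
  \<open>LW\<close> and \<open>LF\<close> are the laws of the generic noise power and the generic fading. Marks are attached
  to the enumerated points, so the enumeration \<open>XM\<close> itself, and not only the set
  of its values, has to be independent of the marks.
\<close>

locale poisson_grid_model = prob_space M
  for M :: "'w measure" +
  fixes lam s q :: real
    and LW LF :: "real measure"
    and XM :: "nat \<Rightarrow> 'w \<Rightarrow> real^2"
    and U :: "'w \<Rightarrow> real^2"
    and e :: "pidx \<Rightarrow> int \<Rightarrow> 'w \<Rightarrow> bool"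
    and W :: "pidx \<Rightarrow> int \<Rightarrow> 'w \<Rightarrow> real"
    and F :: "pidx \<Rightarrow> pidx \<Rightarrow> int \<Rightarrow> 'w \<Rightarrow> real"
  assumes lam_pos: "0 < lam" and s_pos: "0 < s" and q_pos: "0 < q" and q_less_1: "q < 1"
    and poisson: "stationary_poisson_process M lam XM"
    and U_measurable: "U \<in> borel_measurable M"
    and U_uniform: "distr M lborel U = uniform_measure lborel (cbox 0 (\<chi> _. s))"
    and e_measurable: "\<And>i n. e i n \<in> measurable M (count_space UNIV)"
    and e_law: "\<And>i n. distr M (count_space UNIV) (e i n) = measure_pmf (bernoulli_pmf q)"
    and W_measurable: "\<And>i n. W i n \<in> borel_measurable M"
    and W_law: "\<And>i n. distr M borel (W i n) = LW"
    and W_nonneg: "AE r in LW. 0 \<le> r"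
    and F_measurable: "\<And>i j n. F i j n \<in> borel_measurable M"
    and F_law: "\<And>i j n. distr M borel (F i j n) = LF"
    and F_nonneg: "AE r in LF. 0 \<le> r"
    and independent: "indep_sets
      (\<lambda>k. case k of
         Poisson_points \<Rightarrow> sets (vimage_algebra (space M) (\<lambda>\<omega> k. XM k \<omega>) (PiM UNIV (\<lambda>_. borel)))
       | Grid_shift \<Rightarrow> sets (vimage_algebra (space M) U borel)
       | Access i n \<Rightarrow> sets (vimage_algebra (space M) (e i n) (count_space UNIV))
       | Noise i n \<Rightarrow> sets (vimage_algebra (space M) (W i n) borel)
       | Fading i j n \<Rightarrow> sets (vimage_algebra (space M) (F i j n) borel)) UNIV"

section \<open>The space-time SINR graph of a fixed configuration\<close>

definition power_path_loss :: "real \<Rightarrow> real \<Rightarrow> real \<Rightarrow> real" where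
  "power_path_loss A \<beta> r = (A * r) powr \<beta>"

definition interference ::
    "(real \<Rightarrow> real) \<Rightarrow> ('i \<Rightarrow> real^2) \<Rightarrow> ('i \<Rightarrow> int \<Rightarrow> bool) \<Rightarrow> ('i \<Rightarrow> 'i \<Rightarrow> int \<Rightarrow> real)
      \<Rightarrow> 'i \<Rightarrow> 'i \<Rightarrow> int \<Rightarrow> ennreal" where
  "interference l X e F i j n =
     (\<Sum>\<^sub>\<infinity>k\<in>{k. k \<noteq> i \<and> e k n}. ennreal (F k j n / l (norm (X k - X j))))"

definition sinr ::
    "(real \<Rightarrow> real) \<Rightarrow> ('i \<Rightarrow> real^2) \<Rightarrow> ('i \<Rightarrow> int \<Rightarrow> bool) \<Rightarrow> ('i \<Rightarrow> int \<Rightarrow> real)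
      \<Rightarrow> ('i \<Rightarrow> 'i \<Rightarrow> int \<Rightarrow> real) \<Rightarrow> 'i \<Rightarrow> 'i \<Rightarrow> int \<Rightarrow> ennreal" where
  "sinr l X e W F i j n =
     ennreal (F i j n / l (norm (X i - X j))) / (ennreal (W j n) + interference l X e F i j n)"

definition success ::
    "(real \<Rightarrow> real) \<Rightarrow> real \<Rightarrow> ('i \<Rightarrow> real^2) \<Rightarrow> ('i \<Rightarrow> int \<Rightarrow> bool) \<Rightarrow> ('i \<Rightarrow> int \<Rightarrow> real)
      \<Rightarrow> ('i \<Rightarrow> 'i \<Rightarrow> int \<Rightarrow> real) \<Rightarrow> 'i \<Rightarrow> 'i \<Rightarrow> int \<Rightarrow> bool" where
  "success l T X e W F i j n \<longleftrightarrow>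
     i = j \<or> (e i n \<and> \<not> e j n \<and> ennreal T \<le> sinr l X e W F i j n)"

text \<open>The vertex \<open>(i, n)\<close> stands for the space-time point \<open>(X i, n)\<close>.\<close>

definition sinr_graph ::
    "(real \<Rightarrow> real) \<Rightarrow> real \<Rightarrow> ('i \<Rightarrow> real^2) \<Rightarrow> ('i \<Rightarrow> int \<Rightarrow> bool) \<Rightarrow> ('i \<Rightarrow> int \<Rightarrow> real)
      \<Rightarrow> ('i \<Rightarrow> 'i \<Rightarrow> int \<Rightarrow> real) \<Rightarrow> (('i \<times> int) \<times> ('i \<times> int)) set" where
  "sinr_graph l T X e W F = {((i, n), (j, n + 1)) | i j n. success l T X e W F i j n}"

text \<open>Unspecified on the null event that the closest point is not unique.\<close>

definition closest :: "('i \<Rightarrow> real^2) \<Rightarrow> real^2 \<Rightarrow> 'i" where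
  "closest X x = (THE i. \<forall>j. j \<noteq> i \<longrightarrow> dist x (X i) < dist x (X j))"

text \<open>The length of a shortest path; \<open>\<infinity>\<close> if there is none.\<close>

definition path_length ::
    "(real \<Rightarrow> real) \<Rightarrow> real \<Rightarrow> ('i \<Rightarrow> real^2) \<Rightarrow> ('i \<Rightarrow> int \<Rightarrow> bool) \<Rightarrow> ('i \<Rightarrow> int \<Rightarrow> real)
      \<Rightarrow> ('i \<Rightarrow> 'i \<Rightarrow> int \<Rightarrow> real) \<Rightarrow> real^2 \<Rightarrow> real^2 \<Rightarrow> int \<Rightarrow> ennreal" where
  "path_length l T X e W F x y n =
     (INF k \<in> {k. \<exists>m\<ge>1. ((closest X x, n), (closest X y, n + m)) \<in> sinr_graph l T X e W F ^^ k}.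
        of_nat k)"

section \<open>Conditional mean delay and time constant\<close>

definition cond_exp_version ::
    "'w measure \<Rightarrow> 'w measure \<Rightarrow> ('w \<Rightarrow> ennreal) \<Rightarrow> ('w \<Rightarrow> ennreal) \<Rightarrow> bool" where
  "cond_exp_version M G f g \<longleftrightarrow>
     g \<in> borel_measurable G \<and> (AE \<omega> in M. g \<omega> = nn_cond_exp M G f \<omega>)"

text \<open>
  \<open>p x y\<close> is \<open>E[P(x,y,0) | \<Phi>]\<close>. The versions are part of the data: an almost sure limit over the
  uncountably many \<open>t\<close> depends on how they are chosen, whereas the \<open>L\<^sub>1\<close> limit does not.
\<close>

definition mean_delay ::
    "'w measure \<Rightarrow> (real \<Rightarrow> real) \<Rightarrow> real \<Rightarrow> ('i \<Rightarrow> 'w \<Rightarrow> real^2) \<Rightarrow> ('i \<Rightarrow> int \<Rightarrow> 'w \<Rightarrow> bool)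
      \<Rightarrow> ('i \<Rightarrow> int \<Rightarrow> 'w \<Rightarrow> real) \<Rightarrow> ('i \<Rightarrow> 'i \<Rightarrow> int \<Rightarrow> 'w \<Rightarrow> real)
      \<Rightarrow> (real^2 \<Rightarrow> real^2 \<Rightarrow> 'w \<Rightarrow> ennreal) \<Rightarrow> bool" where
  "mean_delay M l T X e W F p \<longleftrightarrow>
     (\<forall>x y. cond_exp_version M (pp_sigma M X)
        (\<lambda>\<omega>. path_length l T (\<lambda>i. X i \<omega>) (\<lambda>i n. e i n \<omega>) (\<lambda>i n. W i n \<omega>) (\<lambda>i j n. F i j n \<omega>) x y 0)
        (p x y))"

text \<open>
  \<open>\<kappa>\<close> is the limit of \<open>p(0, t d, \<Phi>) / t\<close> as \<open>t \<rightarrow> \<infinity>\<close>, almost surely and in \<open>L\<^sub>1\<close>. The quotients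
  are extended real, as \<open>p\<close> may be infinite.
\<close>

definition time_constant ::
    "'w measure \<Rightarrow> (real^2 \<Rightarrow> real^2 \<Rightarrow> 'w \<Rightarrow> ennreal) \<Rightarrow> real^2 \<Rightarrow> ('w \<Rightarrow> real) \<Rightarrow> bool" where
  "time_constant M p d \<kappa> \<longleftrightarrow>
     integrable M \<kappa> \<and>
     (AE \<omega> in M. ((\<lambda>t. enn2ereal (p 0 (t *\<^sub>R d) \<omega>) / ereal t) \<longlongrightarrow> ereal (\<kappa> \<omega>)) at_top) \<and>
     ((\<lambda>t. \<integral>\<^sup>+\<omega>. e2ennreal \<bar>enn2ereal (p 0 (t *\<^sub>R d) \<omega>) / ereal t - ereal (\<kappa> \<omega>)\<bar> \<partial>M)
        \<longlongrightarrow> 0) at_top"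

end

theory Submission
  imports Defs "HOL-Real_Asymp.Real_Asymp"
begin

text \<open>
  The delay between two points can only be sublinear in their distance if the signal
  propagates arbitrarily fast along some path. Because the noise is bounded below by a positive
  constant, a jump over distance \<open>r\<close> needs a fading variable of size at least
  \<open>T * w0 * (A * r) powr \<beta>\<close>, which has probability \<open>exp (- c * r powr \<beta>)\<close>, and this
  decays faster than \<open>exp (- r)\<close>. A first moment bound on the number of fast paths should
  therefore give a finite speed of propagation. Interference only makes jumps harder
  and is dropped.

  Counting paths of points directly fails: a path may shuttle for a long time between the points of
  an exceptionally crowded region, and the expected number of such paths grows superexponentially
  with their length. The plane is divided instead into square cells of the side \<open>s\<close> of the grid.
  Waiting in place is free, so the loops of the sequence of visited cells can be erased: a path of
  at most \<open>n\<close> edges yields a list of pairwise distinct cells in which consecutive cells are joined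
  by successful jumps at increasing times before \<open>n\<close>. Given the points, a jump from cell \<open>y\<close>
  to cell \<open>z\<close> at a given time has conditional probability at most
  \<open>N y * N z * jump_bound y z\<close>, where \<open>N y\<close> is one more than the number of Poisson points in \<open>y\<close>
  (the grid puts one point into each cell), and jumps at different times are conditionally
  independent. In a product of such bounds along distinct cells each \<open>N y\<close> occurs at most squared,
  and the counts in distinct cells are independent. The expected number of traces
  along a given list is thus bounded by a product of second moments and kernels
  (\<open>nn_integral_trace_weight_le\<close>, \<open>nn_integral_link_prod_le\<close>).
  Summed with weight \<open>exp\<close> of the distance travelled, this is at most \<open>K * (1 + K * H) ^ n\<close>
  (\<open>trace_weight_sum_le\<close>), so that going as far as \<open>D\<close> within \<open>n\<close> steps has probability at most
  \<open>exp (- D) * K * (1 + K * H) ^ n\<close> (\<open>emeasure_far_trace_le\<close>). This tends to zero if \<open>D\<close> is a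
  multiple of \<open>t\<close> and \<open>n\<close> is a sufficiently small multiple of \<open>t\<close>.

  To know where a path starts and ends, consider the event that no Poisson point lies within
  distance \<open>s\<close> of \<open>0\<close> or of \<open>t d\<close>. It has a probability bounded below uniformly in \<open>t\<close>, and on it
  the nearest points are almost surely grid points at distance less than \<open>s\<close>. On this event, apart
  from a part of vanishing probability, the delay exceeds a multiple of \<open>t\<close>; hence the mean
  delay grows at least linearly (\<open>nn_integral_delay_linear\<close>). The lower bound
  passes to \<open>\<kappa>\<close> through the \<open>L\<^sub>1\<close> limit (\<open>expectation_pos_of_L1_limit\<close>).
\<close>

section \<open>Loop-erased traces of a path\<close>

text \<open>
  \<open>jump_trace R z0 n ys\<close>: the cells of \<open>ys\<close> can be visited from \<open>z0\<close> on, one after the other, by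
  jumps at strictly increasing times before \<open>n\<close>, a jump at time \<open>k\<close> being admissible if \<open>R k\<close> holds.
  The list is in reverse order of time, so that its head is the current cell.
\<close>

inductive jump_trace :: "(nat \<Rightarrow> 'c \<Rightarrow> 'c \<Rightarrow> bool) \<Rightarrow> 'c \<Rightarrow> nat \<Rightarrow> 'c list \<Rightarrow> bool"
  for R z0 where
  start: "jump_trace R z0 0 [z0]"
| stay: "jump_trace R z0 n ys \<Longrightarrow> jump_trace R z0 (Suc n) ys"
| jump: "jump_trace R z0 n (y # ys) \<Longrightarrow> R n y z \<Longrightarrow> jump_trace R z0 (Suc n) (z # y # ys)"

lemma jump_trace_nonempty: "jump_trace R z0 n ys \<Longrightarrow> ys \<noteq> []"
  by (induction rule: jump_trace.induct) auto

text \<open>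
  Waiting is always possible, so a trace can be stopped at any earlier cell. This is what allows
  loops to be erased.
\<close>

lemma jump_trace_suffix: "jump_trace R z0 n (xs @ ys) \<Longrightarrow> ys \<noteq> [] \<Longrightarrow> jump_trace R z0 n ys"
proof (induction n "xs @ ys" arbitrary: xs rule: jump_trace.induct)
  case start
  then show ?case by (cases xs) (auto intro: jump_trace.intros)
next
  case (stay n)
  then show ?case by (auto intro: jump_trace.intros)
next
  case (jump n y zs z)
  show ?case
  proof (cases xs)
    case Nil
    then show ?thesis using jump by (auto intro: jump_trace.intros)
  next
    case (Cons x xs')
    then have "y # zs = xs' @ ys" using jump by auto
    then show ?thesis using jump by (auto intro: jump_trace.intros)
  qed
qed

lemma jump_trace_mono: "jump_trace R z0 n ys \<Longrightarrow> jump_trace R z0 (n + k) ys"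
  by (induction k) (auto intro: jump_trace.intros)

text \<open>
  One step of loop erasure: if the new cell is already on the list, the trace returns to it by
  discarding everything visited since; otherwise the cell is appended.
\<close>

lemma distinct_jump_trace_step:
  assumes tr: "jump_trace R z0 n ys" "distinct ys" and step: "z = hd ys \<or> R n (hd ys) z"
  shows "\<exists>zs. jump_trace R z0 (Suc n) zs \<and> distinct zs \<and> hd zs = z"
proof (cases "z \<in> set ys")
  case True
  then obtain xs zs where ys: "ys = xs @ z # zs" by (auto simp: in_set_conv_decomp)
  then have "jump_trace R z0 n (z # zs)" using tr jump_trace_suffix by fastforce
  then show ?thesis using tr ys by (intro exI[of _ "z # zs"]) (auto intro: jump_trace.intros)
next
  case False
  obtain y zs where ys: "ys = y # zs" using jump_trace_nonempty[OF tr(1)] by (cases ys) auto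
  then have "R n y z" using step False by auto
  then have "jump_trace R z0 (Suc n) (z # ys)" using tr ys by (auto intro: jump_trace.intros)
  then show ?thesis using False tr by (intro exI[of _ "z # ys"]) auto
qed

text \<open>
  For a list \<open>ys\<close> that starts (at its last entry) in \<open>z0\<close>, the sum over all choices of increasing jump
  times before \<open>n\<close> of the products of the weights \<open>Y\<close> along \<open>ys\<close>. With random weights it bounds the number of ways in which a trace is realised; with the
  kernel \<open>jump_bound\<close>, which does not depend on time, it appears in the bound of the expectation.
\<close>

primrec trace_weight :: "(nat \<Rightarrow> 'c \<Rightarrow> 'c \<Rightarrow> ennreal) \<Rightarrow> 'c \<Rightarrow> nat \<Rightarrow> 'c list \<Rightarrow> ennreal" where
  "trace_weight Y z0 0 ys = of_bool (ys = [z0])"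
| "trace_weight Y z0 (Suc n) ys = trace_weight Y z0 n ys +
     (case ys of z # y # zs \<Rightarrow> trace_weight Y z0 n (y # zs) * Y n y z | _ \<Rightarrow> 0)"

lemma trace_weight_ge_1:
  assumes "jump_trace R z0 n ys" and "\<And>k y z. R k y z \<Longrightarrow> 1 \<le> Y k y z"
  shows "1 \<le> trace_weight Y z0 n ys"
  using assms(1)
proof induction
  case (stay n ys)
  then show ?case by (simp add: add_increasing2)
next
  case (jump n y ys z)
  have "1 * 1 \<le> trace_weight Y z0 n (y # ys) * Y n y z"
    by (intro mult_mono jump assms(2)) auto
  then show ?case by (simp add: add_increasing)
qed auto

text \<open>
  Every link of the list contributes the weights of both its ends, so inner entries count twice.
\<close>

fun link_prod :: "('c \<Rightarrow> ennreal) \<Rightarrow> 'c list \<Rightarrow> ennreal" where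
  "link_prod m (z # y # ys) = m z * m y * link_prod m (y # ys)"
| "link_prod m _ = 1"

lemma link_prod_le:
  assumes "\<And>y. 1 \<le> m y"
  shows "link_prod m ys \<le> (\<Prod>y\<leftarrow>ys. (m y)\<^sup>2)"
proof -
  have sq: "m y \<le> (m y)\<^sup>2" for y
    using mult_left_mono[OF assms[of y], of "m y"] by (simp add: power2_eq_square)
  have "link_prod m (y # ys) \<le> m y * (\<Prod>x\<leftarrow>ys. (m x)\<^sup>2)" for y ys
  proof (induction ys arbitrary: y)
    case (Cons z zs)
    have "link_prod m (y # z # zs) \<le> m y * m z * (m z * (\<Prod>x\<leftarrow>zs. (m x)\<^sup>2))"
      using mult_left_mono[OF Cons.IH[of z], of "m y * m z"] by simp
    then show ?case by (simp add: power2_eq_square ac_simps)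
  qed (simp add: assms)
  note le = this
  show ?thesis
  proof (cases ys)
    case (Cons z zs)
    have "link_prod m (z # zs) \<le> m z * (\<Prod>x\<leftarrow>zs. (m x)\<^sup>2)" by (rule le)
    also have "\<dots> \<le> (m z)\<^sup>2 * (\<Prod>x\<leftarrow>zs. (m x)\<^sup>2)" by (rule mult_right_mono[OF sq]) simp
    finally show ?thesis using Cons by simp
  qed simp
qed

lemma nn_integral_count_space_list_Cons:
  fixes f :: "'c list \<Rightarrow> ennreal"
  assumes "f [] = 0"
  shows "(\<integral>\<^sup>+xs. f xs \<partial>count_space UNIV)
    = (\<integral>\<^sup>+x. \<integral>\<^sup>+xs. f (x # xs) \<partial>count_space UNIV \<partial>count_space UNIV)"
proof -
  have "(\<integral>\<^sup>+x. \<integral>\<^sup>+xs. f (x # xs) \<partial>count_space UNIV \<partial>count_space UNIV)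
      = (\<integral>\<^sup>+p. f (fst p # snd p) \<partial>count_space UNIV)"
    using nn_integral_fst_count_space[of "\<lambda>p. f (fst p # snd p)"] by simp
  also have "\<dots> = (\<integral>\<^sup>+xs. f xs \<partial>count_space ((\<lambda>p. fst p # snd p) ` UNIV))"
    by (intro nn_integral_bij_count_space inj_on_imp_bij_betw) (auto simp: inj_on_def)
  also have "\<dots> = (\<integral>\<^sup>+xs. f xs \<partial>count_space UNIV)"
  proof (intro nn_integral_count_space_eq)
    fix xs :: "'c list"
    assume "xs \<in> UNIV - range (\<lambda>p. fst p # snd p)"
    then have "xs = []" by (cases xs) (auto simp: image_iff)
    then show "f xs = 0" using assms by simp
  qed auto
  finally show ?thesis by simp
qed

lemma trace_weight_Nil [simp]: "trace_weight Y z0 n [] = 0"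
  by (induction n) auto

text \<open>
  The exponential growth rate of the weighted number of traces. At each time step a trace waits or is
  extended by one cell, and the extension costs a factor \<open>K * H\<close> once the submultiplicative
  weight \<open>b\<close> is distributed over the jumps. Summing over lists before expanding the jump
  times avoids binomial coefficients.
\<close>

lemma trace_weight_sum_le:
  fixes g :: "'c \<Rightarrow> 'c \<Rightarrow> ennreal" and b :: "'c \<Rightarrow> 'c \<Rightarrow> ennreal" and K H :: ennreal
  assumes H: "\<And>y. (\<integral>\<^sup>+z. g y z * b y z \<partial>count_space UNIV) \<le> H"
    and b_self: "\<And>y. b y y = 1" and b_triangle: "\<And>x y z. b x z \<le> b x y * b y z"
  shows "(\<integral>\<^sup>+ys. trace_weight (\<lambda>_. g) z0 n ys * K ^ length ys * b z0 (hd ys) \<partial>count_space UNIV)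
    \<le> K * (1 + K * H) ^ n"
proof (induction n)
  case 0
  have "(\<integral>\<^sup>+ys. trace_weight (\<lambda>_. g) z0 0 ys * K ^ length ys * b z0 (hd ys) \<partial>count_space UNIV)
      = (\<integral>\<^sup>+ys. K * indicator {[z0]} ys \<partial>count_space UNIV)"
    by (intro nn_integral_cong) (auto simp: b_self split: split_indicator)
  then show ?case by (simp add: nn_integral_cmult_indicator)
next
  case (Suc n)
  let ?a = "trace_weight (\<lambda>_. g) z0 n"
  let ?S = "\<integral>\<^sup>+ys. ?a ys * K ^ length ys * b z0 (hd ys) \<partial>count_space UNIV"
  let ?J = "\<lambda>ys. (case ys of z # y # zs \<Rightarrow> ?a (y # zs) * g y z | _ \<Rightarrow> 0)
    * K ^ length ys * b z0 (hd ys)"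
  have "(\<integral>\<^sup>+ys. ?J ys \<partial>count_space UNIV)
      = (\<integral>\<^sup>+z. \<integral>\<^sup>+zs. ?J (z # zs) \<partial>count_space UNIV \<partial>count_space UNIV)"
    by (rule nn_integral_count_space_list_Cons) simp
  also have "\<dots> = (\<integral>\<^sup>+zs. \<integral>\<^sup>+z. ?J (z # zs) \<partial>count_space UNIV \<partial>count_space UNIV)"
    using nn_integral_fst_count_space[of "\<lambda>(z, zs). ?J (z # zs)"]
      nn_integral_snd_count_space[of "\<lambda>(z, zs). ?J (z # zs)"] by simp
  also have "\<dots> \<le> (\<integral>\<^sup>+zs. (?a zs * K ^ length zs * b z0 (hd zs)) * (K * H) \<partial>count_space UNIV)"
  proof (intro nn_integral_mono)
    fix zs :: "'c list"
    show "(\<integral>\<^sup>+z. ?J (z # zs) \<partial>count_space UNIV) \<le> (?a zs * K ^ length zs * b z0 (hd zs)) * (K * H)"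
    proof (cases zs)
      case (Cons y ws)
      have "(\<integral>\<^sup>+z. ?J (z # zs) \<partial>count_space UNIV)
          \<le> (\<integral>\<^sup>+z. (?a zs * K ^ length zs * b z0 y * K) * (g y z * b y z) \<partial>count_space UNIV)"
      proof (intro nn_integral_mono)
        fix z
        have "?J (z # zs) = (?a zs * g y z * K ^ Suc (length zs)) * b z0 z" using Cons by simp
        also have "\<dots> \<le> (?a zs * g y z * K ^ Suc (length zs)) * (b z0 y * b y z)"
          by (intro mult_left_mono b_triangle) auto
        finally show "?J (z # zs) \<le> (?a zs * K ^ length zs * b z0 y * K) * (g y z * b y z)"
          by (simp add: ac_simps)
      qed
      also have "\<dots> = (?a zs * K ^ length zs * b z0 y * K) * (\<integral>\<^sup>+z. g y z * b y z \<partial>count_space UNIV)"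
        by (rule nn_integral_cmult) auto
      also have "\<dots> \<le> (?a zs * K ^ length zs * b z0 y * K) * H"
        by (intro mult_left_mono H) auto
      finally show ?thesis using Cons by (simp add: ac_simps)
    qed simp
  qed
  also have "\<dots> = ?S * (K * H)"
    by (rule nn_integral_multc) auto
  finally have J: "(\<integral>\<^sup>+ys. ?J ys \<partial>count_space UNIV) \<le> ?S * (K * H)" .
  have "(\<integral>\<^sup>+ys. trace_weight (\<lambda>_. g) z0 (Suc n) ys * K ^ length ys * b z0 (hd ys) \<partial>count_space UNIV)
      = ?S + (\<integral>\<^sup>+ys. ?J ys \<partial>count_space UNIV)"
    by (subst nn_integral_add[symmetric]) (auto simp: distrib_right)
  also have "\<dots> \<le> ?S * (1 + K * H)"
    using J by (simp add: distrib_left add_left_mono)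
  also have "\<dots> \<le> K * (1 + K * H) ^ n * (1 + K * H)"
    by (intro mult_right_mono Suc) auto
  finally show ?case by (simp add: ac_simps)
qed

section \<open>Countable sums and products\<close>

lemma prod_list_nth: "(\<Prod>x\<leftarrow>xs. f x) = (\<Prod>k<length xs. f (xs ! k))"
  for f :: "'b \<Rightarrow> 'c::comm_monoid_mult"
proof (induction xs)
  case (Cons x xs)
  then show ?case by (simp add: prod.lessThan_Suc_shift del: prod.lessThan_Suc)
qed simp

lemma measurable_nn_integral_count_space:
  fixes f :: "'i::countable \<Rightarrow> 'b \<Rightarrow> ennreal"
  assumes "\<And>i. f i \<in> borel_measurable N"
  shows "(\<lambda>\<omega>. \<integral>\<^sup>+i. f i \<omega> \<partial>count_space UNIV) \<in> borel_measurable N"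
proof -
  interpret sigma_finite_measure "count_space (UNIV :: 'i set)"
    by (rule sigma_finite_measure_count_space_countable) auto
  have "(\<lambda>p. f (snd p) (fst p)) \<in> borel_measurable (N \<Otimes>\<^sub>M count_space (UNIV :: 'i set))"
    using assms
    by (intro measurable_compose_countable'[where f = "\<lambda>i p. f i (fst p)" and g = snd and I = UNIV]) auto
  then show ?thesis
    by (intro borel_measurable_nn_integral) (simp add: split_beta)
qed

text \<open>
  The interference is a sum over a random set of indices. It is the supremum over the countably many
  finite sets of indices of sums in which the indices outside the random set contribute zero.
\<close>

lemma measurable_infsum_ennreal:
  fixes f :: "'i::countable \<Rightarrow> 'b \<Rightarrow> ennreal"
  assumes [measurable]: "\<And>i. f i \<in> borel_measurable N" "\<And>i. Measurable.pred N (Q i)"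
  shows "(\<lambda>\<omega>. \<Sum>\<^sub>\<infinity>i\<in>{i. Q i \<omega>}. f i \<omega>) \<in> borel_measurable N"
proof -
  have "(\<Sum>\<^sub>\<infinity>i\<in>{i. Q i \<omega>}. f i \<omega>) = (SUP I\<in>{I. finite I}. \<Sum>i\<in>I. if Q i \<omega> then f i \<omega> else 0)" for \<omega>
  proof -
    have "(\<Sum>\<^sub>\<infinity>i\<in>{i. Q i \<omega>}. f i \<omega>) = (\<Sum>\<^sub>\<infinity>i. if Q i \<omega> then f i \<omega> else 0)"
      by (rule infsum_cong_neutral) auto
    then show ?thesis by (simp add: nonneg_infsum_complete)
  qed
  moreover have "(\<lambda>\<omega>. SUP I\<in>{I. finite I}. \<Sum>i\<in>I. if Q i \<omega> then f i \<omega> else 0) \<in> borel_measurable N"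
    by (intro borel_measurable_SUP countable_Collect_finite borel_measurable_sum) measurable
  ultimately show ?thesis by simp
qed

text \<open>
  The integers left and right of \<open>c\<close> give one geometric series each; the factor 2 counts the
  term at \<open>c\<close> twice.
\<close>

lemma nn_integral_exp_neg_abs_int:
  "(\<integral>\<^sup>+a. ennreal (exp (- \<bar>real_of_int (a - c)\<bar>)) \<partial>count_space UNIV) \<le> ennreal (2 / (1 - exp (-1)))"
proof -
  \<comment> \<open>An integer is determined by its side of \<open>c\<close> and its distance from \<open>c\<close>.\<close>
  let ?\<sigma> = "\<lambda>a::int. (a < c, nat \<bar>a - c\<bar>)"
  let ?G = "\<lambda>(b::bool, n::nat). ennreal (exp (- real n))"
  have "(\<integral>\<^sup>+a. ennreal (exp (- \<bar>real_of_int (a - c)\<bar>)) \<partial>count_space UNIV)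
      = (\<integral>\<^sup>+a. ?G (?\<sigma> a) \<partial>count_space UNIV)"
    by (intro nn_integral_cong) simp
  also have "\<dots> = (\<integral>\<^sup>+p. ?G p \<partial>count_space (range ?\<sigma>))"
    by (intro nn_integral_bij_count_space inj_on_imp_bij_betw) (auto simp: inj_on_def)
  also have "\<dots> = (\<integral>\<^sup>+p. ?G p * indicator (range ?\<sigma>) p \<partial>count_space UNIV)"
    by (rule nn_integral_count_space_indicator) simp
  also have "\<dots> \<le> (\<integral>\<^sup>+p. ?G p \<partial>count_space UNIV)"
    by (intro nn_integral_mono) (auto split: split_indicator)
  also have "\<dots> = (\<integral>\<^sup>+b. \<integral>\<^sup>+n. ennreal (exp (- real n)) \<partial>count_space UNIV \<partial>count_space (UNIV :: bool set))"
    by (subst nn_integral_fst_count_space[symmetric]) simp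
  also have "(\<integral>\<^sup>+n. ennreal (exp (- real n)) \<partial>count_space UNIV) = (\<Sum>n. ennreal (exp (-1) ^ n))"
    by (simp add: nn_integral_count_space_nat exp_of_nat_mult[symmetric])
  also have "\<dots> = ennreal (1 / (1 - exp (-1)))"
    by (subst suminf_ennreal2) (auto simp: summable_geometric suminf_geometric)
  also have "(\<integral>\<^sup>+b. ennreal (1 / (1 - exp (-1))) \<partial>count_space (UNIV :: bool set))
      = ennreal (2 / (1 - exp (-1)))"
    by (simp add: nn_integral_count_space_finite ennreal_mult'[symmetric] ennreal_numeral[symmetric]
        del: ennreal_numeral)
  finally show ?thesis .
qed

text \<open>
  Beyond \<open>x0 = (3 / c) powr (1 / (\<beta> - 1))\<close> the power wins; below it \<open>3 * x\<close> is at most \<open>3 * x0\<close>.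
\<close>

lemma powr_dominates_linear:
  fixes c \<beta> :: real
  assumes "0 < c" "1 < \<beta>"
  obtains C where "\<And>x. 0 \<le> x \<Longrightarrow> 3 * x \<le> c * x powr \<beta> + C"
proof
  define x0 where "x0 = (3 / c) powr (1 / (\<beta> - 1))"
  fix x :: real assume "0 \<le> x"
  have x0: "0 < x0" "x0 powr (\<beta> - 1) = 3 / c"
    using assms by (auto simp: x0_def powr_powr)
  show "3 * x \<le> c * x powr \<beta> + 3 * x0"
  proof (cases "x \<le> x0")
    case True
    then show ?thesis using assms by (simp add: add_increasing)
  next
    case False
    have "3 / c \<le> x powr (\<beta> - 1)"
      using False x0 assms powr_mono2[of "\<beta> - 1" x0 x] by simp
    then have "3 * x \<le> c * (x powr (\<beta> - 1) * x)"
      using assms False x0(1) by (simp add: field_simps)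
    also have "x powr (\<beta> - 1) * x = x powr \<beta>"
      using False x0(1) by (simp add: powr_diff)
    finally show ?thesis using x0(1) by simp
  qed
qed

section \<open>Fading is independent of the points and of the past\<close>

locale rayleigh_model = poisson_grid_model +
  fixes \<mu> w0 A \<beta> T :: real
  assumes \<mu>_pos: "0 < \<mu>" and LF_exponential: "LF = density lborel (exponential_density \<mu>)"
    and w0_pos: "0 < w0" and LW_constant: "LW = return borel w0"
    and A_pos: "0 < A" and \<beta>_gt_2: "2 < \<beta>" and T_pos: "0 < T"
begin

abbreviation X :: "pidx \<Rightarrow> 'a \<Rightarrow> real^2" where "X \<equiv> poisson_grid s XM U"

definition source_events :: "source \<Rightarrow> 'a set set" where
  "source_events k = (case k of
       Poisson_points \<Rightarrow> sets (vimage_algebra (space M) (\<lambda>\<omega> k. XM k \<omega>) (PiM UNIV (\<lambda>_. borel)))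
     | Grid_shift \<Rightarrow> sets (vimage_algebra (space M) U borel)
     | Access i n \<Rightarrow> sets (vimage_algebra (space M) (e i n) (count_space UNIV))
     | Noise i n \<Rightarrow> sets (vimage_algebra (space M) (W i n) borel)
     | Fading i j n \<Rightarrow> sets (vimage_algebra (space M) (F i j n) borel))"

definition past_sources :: "nat \<Rightarrow> source set" where
  "past_sources n = {Poisson_points, Grid_shift} \<union> {Fading i j m | i j m. m < int n}"

text \<open>
  Traces up to time \<open>n\<close> are determined by \<open>past n\<close>, while the fading at time \<open>n\<close> is independent of it.
  Every \<open>past n\<close> contains the point process.
\<close>

definition past :: "nat \<Rightarrow> 'a measure" where
  "past n = sigma (space M) (\<Union>k\<in>past_sources n. source_events k)"

lemma indep_source_events: "indep_sets source_events UNIV"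
  using independent unfolding source_events_def[abs_def] by simp

lemma source_events_subset: "source_events k \<subseteq> sets M"
  using indep_source_events by (auto simp: indep_sets_def)

lemma source_events_Pow: "(\<Union>k\<in>S. source_events k) \<subseteq> Pow (space M)"
  using source_events_subset sets.sets_into_space by blast

lemma space_past [simp]: "space (past n) = space M"
  unfolding past_def by (rule space_measure_of[OF source_events_Pow])

lemma sets_past: "sets (past n) = sigma_sets (space M) (\<Union>k\<in>past_sources n. source_events k)"
  unfolding past_def by (rule sets_measure_of[OF source_events_Pow])

lemma sets_past_subset: "sets (past n) \<subseteq> sets M"
  unfolding sets_past using source_events_subset by (intro sets.sigma_sets_subset) auto

lemma past_measurable_mono: "m \<le> n \<Longrightarrow> f \<in> measurable (past m) N \<Longrightarrow> f \<in> measurable (past n) N"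
proof -
  assume "m \<le> n" "f \<in> measurable (past m) N"
  moreover have "sets (past m) \<subseteq> sets (past n)"
  proof -
    have "past_sources m \<subseteq> past_sources n"
      using \<open>m \<le> n\<close> by (force simp: past_sources_def)
    then show ?thesis unfolding sets_past by (intro sigma_sets_subseteq) blast
  qed
  ultimately show "f \<in> measurable (past n) N"
    using measurable_mono[of N N "past m" "past n"] by auto
qed

lemma past_measurable_M: "f \<in> measurable (past n) N \<Longrightarrow> f \<in> measurable M N"
  using measurable_mono[of N N "past n" M] sets_past_subset by auto

text \<open>
  A source is measurable with respect to every \<open>past n\<close> that contains its generated sigma-algebra.
\<close>

lemma measurable_source:
  assumes "sets (vimage_algebra (space M) f N) = source_events k" "k \<in> past_sources n"
    and "f \<in> space M \<rightarrow> space N"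
  shows "f \<in> measurable (past n) N"
proof -
  have "f \<in> measurable (vimage_algebra (space M) f N) N"
    by (rule measurable_vimage_algebra1[OF assms(3)])
  moreover have "sets (vimage_algebra (space M) f N) \<subseteq> sets (past n)"
    unfolding sets_past assms(1) using assms(2) by (auto intro: sigma_sets.Basic)
  ultimately show ?thesis
    using measurable_mono[of N N "vimage_algebra (space M) f N" "past n"] by auto
qed

lemma XM_past [measurable]: "XM k \<in> borel_measurable (past n)"
proof -
  have "(\<lambda>\<omega> k. XM k \<omega>) \<in> measurable (past n) (PiM UNIV (\<lambda>_. borel))"
    by (rule measurable_source[of _ _ Poisson_points])
      (auto simp: source_events_def past_sources_def space_PiM)
  from measurable_compose[OF this measurable_component_singleton[of k]] show ?thesis by simp
qed

lemma U_past [measurable]: "U \<in> borel_measurable (past n)"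
  by (rule measurable_source[of _ _ Grid_shift]) (auto simp: source_events_def past_sources_def)

lemma F_past: "m < int n \<Longrightarrow> F i j m \<in> borel_measurable (past n)"
  by (rule measurable_source[of _ _ "Fading i j m"]) (auto simp: source_events_def past_sources_def)

lemma X_past [measurable]: "X i \<in> borel_measurable (past n)"
  unfolding poisson_grid_def[abs_def] by (cases i) (auto split: prod.split)

lemma X_measurable [measurable]: "X i \<in> borel_measurable M"
  using X_past past_measurable_M by blast

lemma XM_measurable [measurable]: "XM k \<in> borel_measurable M"
  using XM_past past_measurable_M by blast

lemma prob_fading_gt:
  assumes "0 \<le> c"
  shows "prob {\<omega>\<in>space M. c < F i j n \<omega>} = exp (- \<mu> * c)"
proof -
  have "distributed M lborel (F i j n) (exponential_density \<mu>)"
    unfolding distributed_def using F_measurable F_law[of i j n] LF_exponential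
    by (auto simp: distr_def)
  from exponential_distributedD_gt[OF this assms \<mu>_pos] show ?thesis by (simp add: ac_simps)
qed

text \<open>
  The only place where independence of the marks is used: a fading variable of time \<open>n\<close> factors out of
  the integral of anything that is determined by the points and by the earlier fading. It takes the
  place of conditioning on the points.
\<close>

lemma nn_integral_past_fading:
  assumes V: "V \<in> borel_measurable (past n)" and c: "0 \<le> c"
  shows "(\<integral>\<^sup>+\<omega>. V \<omega> * of_bool (c < F i j (int n) \<omega>) \<partial>M) = (\<integral>\<^sup>+\<omega>. V \<omega> \<partial>M) * ennreal (exp (- \<mu> * c))"
proof -
  note [measurable] = F_measurable past_measurable_M[OF V]
  let ?G = "\<lambda>\<omega>. of_bool (c < F i j (int n) \<omega>) :: ennreal"
  let ?I = "\<lambda>b. if b then past_sources n else {Fading i j (int n)}"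
  \<comment> \<open>Two disjoint groups of sources: those of the past, and the one fading variable.\<close>
  have "indep_sets (\<lambda>b. sigma_sets (space M) (\<Union>k\<in>?I b. source_events k)) (UNIV::bool set)"
  proof (rule indep_sets_collect_sigma)
    show "indep_sets source_events (\<Union>b\<in>UNIV. ?I b)"
      by (rule indep_sets_mono_index[OF _ indep_source_events]) auto
    show "Int_stable (source_events k)" for k
      unfolding source_events_def by (cases k) (auto intro: sets.Int_stable)
    show "disjoint_family_on ?I UNIV"
      by (auto simp: disjoint_family_on_def past_sources_def)
  qed
  then have ind: "indep_set (sets (past n)) (sigma_sets (space M) (source_events (Fading i j (int n))))"
    unfolding indep_set_def sets_past
    by (rule indep_sets_mono_sets) (auto split: bool.splits)
  have "indep_var borel V borel ?G"
    unfolding indep_var_eq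
  proof (intro conjI)
    show "indep_set (sigma_sets (space M) {V -` B \<inter> space M |B. B \<in> sets borel})
        (sigma_sets (space M) {?G -` B \<inter> space M |B. B \<in> sets borel})"
      unfolding indep_set_def
    proof (rule indep_sets_mono_sets[OF ind[unfolded indep_set_def]])
      fix b :: bool assume "b \<in> UNIV"
      have "sigma_sets (space M) {V -` B \<inter> space M |B. B \<in> sets borel} \<subseteq> sets (past n)"
        using sets.sigma_sets_subset[of "{V -` B \<inter> space M |B. B \<in> sets borel}" "past n"]
          measurable_sets[OF V] by auto
      moreover have "{?G -` B \<inter> space M |B. B \<in> sets borel} \<subseteq> source_events (Fading i j (int n))"
      proof safe
        fix B :: "ennreal set"
        have *: "?G \<in> borel_measurable (vimage_algebra (space M) (F i j (int n)) borel)"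
          using measurable_vimage_algebra1[of "F i j (int n)" "space M" borel] by measurable
        assume "B \<in> sets borel"
        from measurable_sets[OF * this] show "?G -` B \<inter> space M \<in> source_events (Fading i j (int n))"
          by (simp add: source_events_def)
      qed
      ultimately show "(case b of True \<Rightarrow> sigma_sets (space M) {V -` B \<inter> space M |B. B \<in> sets borel}
          | False \<Rightarrow> sigma_sets (space M) {?G -` B \<inter> space M |B. B \<in> sets borel})
        \<subseteq> (case b of True \<Rightarrow> sets (past n) | False \<Rightarrow> sigma_sets (space M) (source_events (Fading i j (int n))))"
        by (auto split: bool.splits dest: sigma_sets_mono'[THEN subsetD])
    qed
  qed measurable
  then have "indep_vars (\<lambda>_. borel) (case_bool V ?G) (UNIV :: bool set)"
    unfolding indep_var_def by (rule indep_vars_cong[THEN iffD1, rotated -1]) (auto split: bool.split)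
  then have "(\<integral>\<^sup>+\<omega>. (\<Prod>b\<in>UNIV. case_bool V ?G b \<omega>) \<partial>M) = (\<Prod>b\<in>UNIV. \<integral>\<^sup>+\<omega>. case_bool V ?G b \<omega> \<partial>M)"
    by (intro indep_vars_nn_integral) auto
  then have "(\<integral>\<^sup>+\<omega>. V \<omega> * ?G \<omega> \<partial>M) = (\<integral>\<^sup>+\<omega>. V \<omega> \<partial>M) * (\<integral>\<^sup>+\<omega>. ?G \<omega> \<partial>M)"
    by (simp add: UNIV_bool ac_simps)
  also have "(\<integral>\<^sup>+\<omega>. ?G \<omega> \<partial>M) = (\<integral>\<^sup>+\<omega>. indicator {\<omega>\<in>space M. c < F i j (int n) \<omega>} \<omega> \<partial>M)"
    by (intro nn_integral_cong) (auto split: split_indicator)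
  also have "\<dots> = ennreal (exp (- \<mu> * c))"
    using prob_fading_gt[OF c] by (simp add: emeasure_eq_measure)
  finally show ?thesis .
qed

section \<open>Cells, occupation numbers and expected crossings\<close>

definition cell_dist :: "int \<times> int \<Rightarrow> int \<times> int \<Rightarrow> int" where
  "cell_dist y z = max \<bar>fst z - fst y\<bar> \<bar>snd z - snd y\<bar>"

lemma cell_dist_triangle: "cell_dist x z \<le> cell_dist x y + cell_dist y z"
  by (auto simp: cell_dist_def)

definition cell :: "real^2 \<Rightarrow> int \<times> int" where
  "cell x = (\<lfloor>x $ 1 / s\<rfloor>, \<lfloor>x $ 2 / s\<rfloor>)"

text \<open>
  The fading that a jump between points of these two cells needs at least, whatever the positions
  of the points inside the cells: they are further apart than \<open>s * (cell_dist y z - 1)\<close>.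
  For \<open>cell_dist y z = 0\<close> the base of the power is negative and the value is merely some nonnegative
  number; it is harmless because loop-free traces record only jumps between different cells.
\<close>

definition fading_threshold :: "int \<times> int \<Rightarrow> int \<times> int \<Rightarrow> real" where
  "fading_threshold y z = T * w0 * (A * (s * (real_of_int (cell_dist y z) - 1))) powr \<beta>"

definition jump_bound :: "int \<times> int \<Rightarrow> int \<times> int \<Rightarrow> ennreal" where
  "jump_bound y z = ennreal (exp (- \<mu> * fading_threshold y z))"

definition crossings :: "'a \<Rightarrow> nat \<Rightarrow> int \<times> int \<Rightarrow> int \<times> int \<Rightarrow> ennreal" where
  "crossings \<omega> n y z = (\<integral>\<^sup>+(i, j). of_bool (cell (X i \<omega>) = y) * of_bool (cell (X j \<omega>) = z)
     * of_bool (fading_threshold y z < F i j (int n) \<omega>) \<partial>count_space UNIV)"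

text \<open>
  One is added for the single grid point of the cell.
\<close>

definition occupancy :: "'a \<Rightarrow> int \<times> int \<Rightarrow> ennreal" where
  "occupancy \<omega> z = pt_count (\<lambda>k. XM k \<omega>) (cell -` {z}) + 1"

lemma cell_measurable [measurable]: "cell \<in> measurable borel (count_space UNIV)"
proof -
  have "(\<lambda>x::real^2. x $ 1) \<in> borel_measurable borel" "(\<lambda>x::real^2. x $ 2) \<in> borel_measurable borel"
    by (auto intro!: borel_measurable_continuous_onI continuous_intros)
  note [measurable] = this
  show ?thesis
    unfolding cell_def[abs_def] by measurable
qed

lemma cell_eq_iff:
  "cell x = (a, b) \<longleftrightarrow> s * a \<le> x $ 1 \<and> x $ 1 < s * (a + 1) \<and> s * b \<le> x $ 2 \<and> x $ 2 < s * (b + 1)"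
  unfolding cell_def using s_pos by (auto simp: floor_eq_iff field_simps)

lemma cell_sets [measurable]: "cell -` {z} \<in> sets borel"
  using measurable_sets[OF cell_measurable, of "{z}"] by simp

lemma cell_subset_cbox:
  "cell -` {(a, b)} \<subseteq> cbox (vector [s * a, s * b]) (vector [s * (a + 1), s * (b + 1)])"
  by (auto simp: cell_eq_iff mem_box_cart forall_2)

lemma bounded_cell: "bounded (cell -` {z})"
  using cell_subset_cbox[of "fst z" "snd z"] bounded_subset[OF bounded_cbox] by auto

lemma measure_cell_le: "measure lborel (cell -` {z}) \<le> s\<^sup>2"
proof -
  let ?C = "cbox (vector [s * fst z, s * snd z]) (vector [s * (fst z + 1), s * (snd z + 1)]) :: (real^2) set"
  have "measure lborel (cell -` {z}) \<le> measure lborel ?C"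
    using cell_subset_cbox[of "fst z" "snd z"]
    by (intro measure_mono_fmeasurable) (auto simp: fmeasurable_cbox)
  also have "\<dots> = s\<^sup>2"
    using s_pos
    by (subst content_cbox_cart)
      (auto simp: interval_ne_empty_cart box_ne_empty forall_2 UNIV_2 power2_eq_square algebra_simps)
  finally show ?thesis .
qed

lemma pt_count_measurable:
  fixes Y :: "'i::countable \<Rightarrow> 'b \<Rightarrow> real^2"
  assumes "\<And>i. Y i \<in> borel_measurable N" "B \<in> sets borel"
  shows "(\<lambda>\<omega>. pt_count (\<lambda>i. Y i \<omega>) B) \<in> borel_measurable N"
proof -
  note [measurable] = assms
  have "pt_count (\<lambda>i. Y i \<omega>) B = (\<integral>\<^sup>+i. of_bool (Y i \<omega> \<in> B) \<partial>count_space UNIV)" for \<omega>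
  proof -
    have "(\<integral>\<^sup>+i. of_bool (Y i \<omega> \<in> B) \<partial>count_space UNIV)
        = (\<integral>\<^sup>+i. indicator {i. Y i \<omega> \<in> B} i \<partial>count_space UNIV)"
      by (intro nn_integral_cong) (auto split: split_indicator)
    then show ?thesis by (simp add: pt_count_def)
  qed
  moreover have "(\<lambda>\<omega>. \<integral>\<^sup>+i. of_bool (Y i \<omega> \<in> B) \<partial>count_space UNIV) \<in> borel_measurable N"
    by (rule measurable_nn_integral_count_space) measurable
  ultimately show ?thesis by simp
qed

lemma occupancy_past [measurable]: "(\<lambda>\<omega>. occupancy \<omega> z) \<in> borel_measurable (past n)"
  unfolding occupancy_def by (intro borel_measurable_add pt_count_measurable) auto

text \<open>
  Two grid points in the same cell would differ by a multiple of \<open>s\<close> in each coordinate while having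
  the same integer part after division by \<open>s\<close>, so they coincide.
\<close>

lemma count_points_in_cell_le:
  "(\<integral>\<^sup>+i. of_bool (cell (X i \<omega>) = z) \<partial>count_space UNIV) \<le> occupancy \<omega> z"
proof -
  let ?P = "{k. cell (XM k \<omega>) = z}"
  let ?G = "{g. cell (X (Inr g) \<omega>) = z}"
  have "(\<integral>\<^sup>+i. of_bool (cell (X i \<omega>) = z) \<partial>count_space UNIV)
      = (\<integral>\<^sup>+i. indicator {i. cell (X i \<omega>) = z} i \<partial>count_space UNIV)"
    by (intro nn_integral_cong) (auto split: split_indicator)
  also have "\<dots> = emeasure (count_space UNIV) {i. cell (X i \<omega>) = z}"
    by simp
  also have "{i. cell (X i \<omega>) = z} = Inl ` ?P \<union> Inr ` ?G"
  proof (rule set_eqI)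
    fix i :: pidx
    show "i \<in> {i. cell (X i \<omega>) = z} \<longleftrightarrow> i \<in> Inl ` ?P \<union> Inr ` ?G"
      by (cases i) (auto simp: poisson_grid_def image_iff)
  qed
  also have "emeasure (count_space UNIV) \<dots>
      \<le> emeasure (count_space UNIV) (Inl ` ?P :: pidx set) + emeasure (count_space UNIV) (Inr ` ?G :: pidx set)"
    by (rule emeasure_subadditive) auto
  also have "emeasure (count_space UNIV) (Inl ` ?P :: pidx set) = emeasure (count_space UNIV) ?P"
    by (auto simp: emeasure_count_space card_image finite_image_iff)
  also have "\<dots> = pt_count (\<lambda>k. XM k \<omega>) (cell -` {z})"
    by (simp add: pt_count_def)
  also have "emeasure (count_space UNIV) (Inr ` ?G :: pidx set) \<le> 1"
  proof -
    have "g = h" if "g \<in> ?G" "h \<in> ?G" for g h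
    proof -
      have eq: "\<lfloor>(U \<omega> $ 1 + s * fst g) / s\<rfloor> = \<lfloor>(U \<omega> $ 1 + s * fst h) / s\<rfloor>"
        "\<lfloor>(U \<omega> $ 2 + s * snd g) / s\<rfloor> = \<lfloor>(U \<omega> $ 2 + s * snd h) / s\<rfloor>"
        using that by (auto simp: cell_def poisson_grid_def vector_2 split: prod.splits)
      have "(U \<omega> $ k + s * real_of_int a) / s = U \<omega> $ k / s + real_of_int a" for k a
        using s_pos by (simp add: field_simps)
      then show ?thesis using eq by (simp add: prod_eq_iff)
    qed
    then have "?G = {} \<or> (\<exists>g. ?G = {g})" by blast
    then show ?thesis
    proof
      assume "?G = {}"
      then show ?thesis unfolding \<open>?G = {}\<close> by simp
    next
      assume "\<exists>g. ?G = {g}"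
      then obtain g where "?G = {g}" by blast
      then show ?thesis unfolding \<open>?G = {g}\<close> by simp
    qed
  qed
  finally show ?thesis by (simp add: occupancy_def add_left_mono)
qed

lemma fading_threshold_nonneg: "0 \<le> fading_threshold y z"
  unfolding fading_threshold_def using T_pos w0_pos by simp

lemma crossings_past:
  assumes "m < n"
  shows "(\<lambda>\<omega>. crossings \<omega> m y z) \<in> borel_measurable (past n)"
proof -
  have [measurable]: "F i j (int m) \<in> borel_measurable (past n)" for i j
    using assms by (intro F_past) simp
  show ?thesis unfolding crossings_def split_beta by (rule measurable_nn_integral_count_space) measurable
qed

text \<open>
  For a fixed pair of indices the positions belong to \<open>past n\<close>, so the fading event can be integrated out, and summing over
  the indices leaves the product of the two occupation numbers.
\<close>

lemma nn_integral_crossings_le: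
  assumes V: "V \<in> borel_measurable (past n)"
  shows "(\<integral>\<^sup>+\<omega>. V \<omega> * crossings \<omega> n y z \<partial>M)
    \<le> jump_bound y z * (\<integral>\<^sup>+\<omega>. V \<omega> * (occupancy \<omega> z * occupancy \<omega> y) \<partial>M)"
proof -
  note [measurable] = V past_measurable_M[OF V] F_measurable
  let ?c = "fading_threshold y z"
  \<comment> \<open>The part of the summand that is determined by the points.\<close>
  define pos where "pos = (\<lambda>\<omega> p. of_bool (cell (X (fst p) \<omega>) = y) * of_bool (cell (X (snd p) \<omega>) = z) :: ennreal)"
  have [measurable]: "(\<lambda>\<omega>. pos \<omega> p) \<in> borel_measurable (past m)" for p m
    unfolding pos_def by measurable
  have [measurable]: "(\<lambda>\<omega>. pos \<omega> p) \<in> borel_measurable M" for p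
    unfolding pos_def by measurable
  have "(\<integral>\<^sup>+\<omega>. V \<omega> * crossings \<omega> n y z \<partial>M) = (\<integral>\<^sup>+\<omega>. \<integral>\<^sup>+p. V \<omega> * pos \<omega> p
      * of_bool (?c < F (fst p) (snd p) (int n) \<omega>) \<partial>count_space UNIV \<partial>M)"
    by (simp add: crossings_def pos_def split_beta nn_integral_cmult[symmetric] mult.assoc)
  also have "\<dots> = (\<integral>\<^sup>+p. \<integral>\<^sup>+\<omega>. V \<omega> * pos \<omega> p
      * of_bool (?c < F (fst p) (snd p) (int n) \<omega>) \<partial>M \<partial>count_space UNIV)"
    by (rule nn_integral_count_space_nn_integral) auto
  also have "\<dots> = (\<integral>\<^sup>+p. (\<integral>\<^sup>+\<omega>. V \<omega> * pos \<omega> p \<partial>M) * jump_bound y z \<partial>count_space UNIV)"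
    unfolding jump_bound_def
    by (intro nn_integral_cong nn_integral_past_fading fading_threshold_nonneg) auto
  also have "\<dots> = (\<integral>\<^sup>+p. \<integral>\<^sup>+\<omega>. V \<omega> * pos \<omega> p \<partial>M \<partial>count_space UNIV) * jump_bound y z"
    by (rule nn_integral_multc) auto
  also have "(\<integral>\<^sup>+p. \<integral>\<^sup>+\<omega>. V \<omega> * pos \<omega> p \<partial>M \<partial>count_space UNIV)
      = (\<integral>\<^sup>+\<omega>. \<integral>\<^sup>+p. V \<omega> * pos \<omega> p \<partial>count_space UNIV \<partial>M)"
    by (rule nn_integral_count_space_nn_integral[symmetric]) auto
  also have "\<dots> = (\<integral>\<^sup>+\<omega>. V \<omega> * (\<integral>\<^sup>+p. pos \<omega> p \<partial>count_space UNIV) \<partial>M)"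
    by (simp add: nn_integral_cmult)
  also have "\<dots> \<le> (\<integral>\<^sup>+\<omega>. V \<omega> * (occupancy \<omega> z * occupancy \<omega> y) \<partial>M)"
  proof (intro nn_integral_mono mult_left_mono)
    fix \<omega>
    have "(\<integral>\<^sup>+p. pos \<omega> p \<partial>count_space UNIV) = (\<integral>\<^sup>+i. \<integral>\<^sup>+j. pos \<omega> (i, j) \<partial>count_space UNIV \<partial>count_space UNIV)"
      by (rule nn_integral_fst_count_space[symmetric])
    also have "\<dots> = (\<integral>\<^sup>+i. of_bool (cell (X i \<omega>) = y) \<partial>count_space UNIV)
        * (\<integral>\<^sup>+j. of_bool (cell (X j \<omega>) = z) \<partial>count_space UNIV)"
      by (simp add: pos_def nn_integral_cmult nn_integral_multc)
    also have "\<dots> \<le> occupancy \<omega> y * occupancy \<omega> z"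
      by (intro mult_mono count_points_in_cell_le) auto
    finally show "(\<integral>\<^sup>+p. pos \<omega> p \<partial>count_space UNIV) \<le> occupancy \<omega> z * occupancy \<omega> y"
      by (simp add: ac_simps)
  qed auto
  finally show ?thesis by (simp add: ac_simps mult_right_mono)
qed

lemma trace_weight_past:
  "(\<lambda>\<omega>. trace_weight (crossings \<omega>) z0 n ys) \<in> borel_measurable (past n)"
proof (induction n arbitrary: ys)
  case (Suc n)
  have [measurable]: "(\<lambda>\<omega>. trace_weight (crossings \<omega>) z0 n ys) \<in> borel_measurable (past (Suc n))" for ys
    using past_measurable_mono[OF _ Suc.IH] by simp
  have [measurable]: "(\<lambda>\<omega>. crossings \<omega> n y z) \<in> borel_measurable (past (Suc n))" for y z
    by (rule crossings_past) simp
  show ?case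
    by (cases ys; cases "tl ys") auto
qed auto

text \<open>
  Induction on time. The factor \<open>V\<close> has to be general, because integrating out the last jump
  multiplies it by the occupation numbers of the last two cells. These are functions of
  the points alone, so they stay inside the integral until all fading variables have been removed.
\<close>

lemma nn_integral_trace_weight_le:
  assumes "V \<in> borel_measurable (past 0)"
  shows "(\<integral>\<^sup>+\<omega>. trace_weight (crossings \<omega>) z0 n ys * V \<omega> \<partial>M)
    \<le> trace_weight (\<lambda>_. jump_bound) z0 n ys * (\<integral>\<^sup>+\<omega>. V \<omega> * link_prod (occupancy \<omega>) ys \<partial>M)"
  using assms
proof (induction n arbitrary: ys V)
  case (Suc n)
  note V = Suc.prems
  have [measurable]: "(\<lambda>\<omega>. trace_weight (crossings \<omega>) z0 n ys) \<in> borel_measurable M" for ys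
    using past_measurable_M[OF trace_weight_past] .
  have [measurable]: "(\<lambda>\<omega>. crossings \<omega> n y z) \<in> borel_measurable M" for y z
    using past_measurable_M[OF crossings_past[of n "Suc n"]] by simp
  have [measurable]: "V \<in> borel_measurable M" "V \<in> borel_measurable (past n)"
    "V \<in> borel_measurable (past 0)"
    using past_measurable_M[OF V] past_measurable_mono[OF _ V, of n] V by auto
  have stay: "(\<integral>\<^sup>+\<omega>. trace_weight (crossings \<omega>) z0 n ys * V \<omega> \<partial>M)
      \<le> trace_weight (\<lambda>_. jump_bound) z0 n ys * (\<integral>\<^sup>+\<omega>. V \<omega> * link_prod (occupancy \<omega>) ys \<partial>M)"
    by (rule Suc.IH[OF V])
  show ?case
  proof (cases "\<exists>z y zs. ys = z # y # zs")
    case False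
    then have "(case ys of z # y # zs \<Rightarrow> h z y zs | _ \<Rightarrow> 0) = (0 :: ennreal)" for h :: "_ \<Rightarrow> _ \<Rightarrow> _ \<Rightarrow> ennreal"
      by (auto split: list.splits)
    then show ?thesis using stay by simp
  next
    case True
    then obtain z y zs where ys: "ys = z # y # zs" by auto
    have "(\<integral>\<^sup>+\<omega>. (trace_weight (crossings \<omega>) z0 n (y # zs) * V \<omega>) * crossings \<omega> n y z \<partial>M)
        \<le> jump_bound y z * (\<integral>\<^sup>+\<omega>. (trace_weight (crossings \<omega>) z0 n (y # zs) * V \<omega>)
            * (occupancy \<omega> z * occupancy \<omega> y) \<partial>M)"
      by (intro nn_integral_crossings_le borel_measurable_times_ennreal trace_weight_past) measurable
    also have "\<dots> = jump_bound y z * (\<integral>\<^sup>+\<omega>. trace_weight (crossings \<omega>) z0 n (y # zs)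
            * (V \<omega> * (occupancy \<omega> z * occupancy \<omega> y)) \<partial>M)"
      by (simp add: ac_simps)
    also have "\<dots> \<le> jump_bound y z * (trace_weight (\<lambda>_. jump_bound) z0 n (y # zs)
        * (\<integral>\<^sup>+\<omega>. (V \<omega> * (occupancy \<omega> z * occupancy \<omega> y)) * link_prod (occupancy \<omega>) (y # zs) \<partial>M))"
      by (intro mult_left_mono Suc.IH) auto
    also have "\<dots> = trace_weight (\<lambda>_. jump_bound) z0 n (y # zs) * jump_bound y z
        * (\<integral>\<^sup>+\<omega>. V \<omega> * link_prod (occupancy \<omega>) ys \<partial>M)"
      by (simp add: ys ac_simps)
    finally have jump: "(\<integral>\<^sup>+\<omega>. (trace_weight (crossings \<omega>) z0 n (y # zs) * V \<omega>) * crossings \<omega> n y z \<partial>M)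
        \<le> trace_weight (\<lambda>_. jump_bound) z0 n (y # zs) * jump_bound y z
          * (\<integral>\<^sup>+\<omega>. V \<omega> * link_prod (occupancy \<omega>) ys \<partial>M)" .
    have "(\<integral>\<^sup>+\<omega>. trace_weight (crossings \<omega>) z0 (Suc n) ys * V \<omega> \<partial>M)
        = (\<integral>\<^sup>+\<omega>. trace_weight (crossings \<omega>) z0 n ys * V \<omega>
          + (trace_weight (crossings \<omega>) z0 n (y # zs) * V \<omega>) * crossings \<omega> n y z \<partial>M)"
      by (intro nn_integral_cong) (simp add: ys distrib_left distrib_right ac_simps)
    also have "\<dots> = (\<integral>\<^sup>+\<omega>. trace_weight (crossings \<omega>) z0 n ys * V \<omega> \<partial>M)
        + (\<integral>\<^sup>+\<omega>. (trace_weight (crossings \<omega>) z0 n (y # zs) * V \<omega>) * crossings \<omega> n y z \<partial>M)"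
      by (rule nn_integral_add) auto
    finally show ?thesis
      using add_mono[OF stay jump] by (simp add: ys distrib_right)
  qed
qed auto

section \<open>The jump kernel is summable\<close>

text \<open>
  Since \<open>\<beta> > 1\<close>, the exponent \<open>- \<mu> * fading_threshold y z\<close> lies below \<open>- 3 * cell_dist y z\<close> up to
  a constant. One of the three units pays for the weight \<open>exp (cell_dist y z)\<close>, and the other two
  leave summable factors in each of the two coordinates, as \<open>2 * cell_dist y z\<close> dominates the sum of the
  coordinate differences.
\<close>

lemma jump_bound_summable:
  obtains H :: real where "0 \<le> H"
    and "\<And>y. (\<integral>\<^sup>+z. jump_bound y z * ennreal (exp (cell_dist y z)) \<partial>count_space UNIV) \<le> ennreal H"
proof -
  define c where "c = \<mu> * T * w0 * (A * s) powr \<beta>"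
  have "0 < c" unfolding c_def using \<mu>_pos T_pos w0_pos A_pos s_pos by simp
  then obtain C where C: "\<And>x. 0 \<le> x \<Longrightarrow> 3 * x \<le> c * x powr \<beta> + C"
    using powr_dominates_linear[of c \<beta>] \<beta>_gt_2 by auto
  have "0 \<le> C" using C[of 0] by simp
  have bd: "- \<mu> * fading_threshold y z + cell_dist y z
      \<le> C + 3 - \<bar>real_of_int (fst z - fst y)\<bar> - \<bar>real_of_int (snd z - snd y)\<bar>" for y z
  proof -
    let ?k = "real_of_int (cell_dist y z)"
    have "\<bar>fst z - fst y\<bar> + \<bar>snd z - snd y\<bar> \<le> 2 * cell_dist y z" "0 \<le> cell_dist y z"
      by (auto simp: cell_dist_def max_def)
    then have k: "\<bar>real_of_int (fst z - fst y)\<bar> + \<bar>real_of_int (snd z - snd y)\<bar> \<le> 2 * ?k" "0 \<le> ?k"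
      by linarith+
    show ?thesis
    proof (cases "cell_dist y z = 0")
      case True
      then have "?k = 0" by simp
      moreover have "0 \<le> \<mu> * fading_threshold y z"
        using fading_threshold_nonneg \<mu>_pos by simp
      ultimately show ?thesis using k \<open>0 \<le> C\<close> by linarith
    next
      case False
      then have "1 \<le> ?k" by (auto simp: cell_dist_def)
      then have "\<mu> * fading_threshold y z = c * (?k - 1) powr \<beta>"
        using A_pos s_pos by (simp add: fading_threshold_def c_def powr_mult mult.assoc)
      then show ?thesis using C[of "?k - 1"] \<open>1 \<le> ?k\<close> k by simp
    qed
  qed
  let ?S = "2 / (1 - exp (-1)) :: real"
  have "(\<integral>\<^sup>+z. jump_bound y z * ennreal (exp (cell_dist y z)) \<partial>count_space UNIV)
      \<le> ennreal (exp (C + 3) * (?S * ?S))" for y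
  proof -
    let ?f = "\<lambda>a. ennreal (exp (- \<bar>real_of_int (a - fst y)\<bar>))"
    let ?g = "\<lambda>b. ennreal (exp (- \<bar>real_of_int (b - snd y)\<bar>))"
    have "(\<integral>\<^sup>+z. jump_bound y z * ennreal (exp (cell_dist y z)) \<partial>count_space UNIV)
        \<le> (\<integral>\<^sup>+z. ennreal (exp (C + 3)) * (?f (fst z) * ?g (snd z)) \<partial>count_space UNIV)"
    proof (intro nn_integral_mono)
      fix z
      have "exp (- \<mu> * fading_threshold y z + cell_dist y z)
          \<le> exp (C + 3 - \<bar>real_of_int (fst z - fst y)\<bar> - \<bar>real_of_int (snd z - snd y)\<bar>)"
        using bd by simp
      then show "jump_bound y z * ennreal (exp (cell_dist y z))
          \<le> ennreal (exp (C + 3)) * (?f (fst z) * ?g (snd z))"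
        unfolding jump_bound_def ennreal_mult[symmetric, OF exp_ge_zero exp_ge_zero]
        by (subst ennreal_mult[symmetric], simp, simp)
          (intro ennreal_leI, simp only: exp_add[symmetric] mult_exp_exp, simp add: algebra_simps)
    qed
    also have "\<dots> = ennreal (exp (C + 3)) * (\<integral>\<^sup>+z. ?f (fst z) * ?g (snd z) \<partial>count_space UNIV)"
      by (rule nn_integral_cmult) simp
    also have "(\<integral>\<^sup>+z. ?f (fst z) * ?g (snd z) \<partial>count_space UNIV)
        = (\<integral>\<^sup>+a. ?f a \<partial>count_space UNIV) * (\<integral>\<^sup>+b. ?g b \<partial>count_space UNIV)"
      by (subst nn_integral_fst_count_space[symmetric]) (simp add: nn_integral_cmult nn_integral_multc)
    also have "ennreal (exp (C + 3)) * \<dots> \<le> ennreal (exp (C + 3)) * (ennreal ?S * ennreal ?S)"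
      by (intro mult_left_mono mult_mono nn_integral_exp_neg_abs_int) auto
    also have "\<dots> = ennreal (exp (C + 3) * (?S * ?S))"
      by (simp add: ennreal_mult[symmetric])
    finally show ?thesis .
  qed
  then show thesis using that[of "exp (C + 3) * (?S * ?S)"] by simp
qed

section \<open>Second moments of the Poisson cell counts\<close>

definition occupancy_moment :: ennreal where
  "occupancy_moment = ennreal (exp (4 * lam * s\<^sup>2))"

lemma cell_count_prob:
  "prob {\<omega>\<in>space M. pt_count (\<lambda>k. XM k \<omega>) (cell -` {z}) = of_nat k} =
    (lam * measure lborel (cell -` {z})) ^ k / fact k * exp (- (lam * measure lborel (cell -` {z})))"
  using poisson[unfolded stationary_poisson_process_def, THEN conjunct2, THEN conjunct1, rule_format]
  by (simp add: bounded_cell)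

text \<open>
  With \<open>(k + 1)\<^sup>2 \<le> 4 ^ k\<close> the second moment of a Poisson variable plus one is bounded by an exponential
  series. The Poisson probabilities sum to one, so that the count is almost surely a natural number.
\<close>

lemma nn_integral_occupancy_sq_le: "(\<integral>\<^sup>+\<omega>. (occupancy \<omega> z)\<^sup>2 \<partial>M) \<le> occupancy_moment"
proof -
  define N where "N = (\<lambda>\<omega>. pt_count (\<lambda>k. XM k \<omega>) (cell -` {z}))"
  define m where "m = lam * measure lborel (cell -` {z})"
  define E where "E = (\<lambda>k::nat. {\<omega>\<in>space M. N \<omega> = of_nat k})"
  have [measurable]: "N \<in> borel_measurable M"
    unfolding N_def by (rule pt_count_measurable) auto
  have E_sets [measurable]: "E k \<in> sets M" for k
    unfolding E_def by measurable
  have prob_E: "prob (E k) = m ^ k / fact k * exp (- m)" for k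
    using cell_count_prob[of z k] by (simp add: E_def N_def m_def)
  have m: "0 \<le> m" "m \<le> lam * s\<^sup>2"
    using lam_pos measure_cell_le[of z] by (auto simp: m_def)
  have "(\<lambda>k. prob (E k)) sums prob (\<Union>k. E k)"
    by (rule finite_measure_UNION) (auto simp: disjoint_family_on_def E_def)
  moreover have "(\<lambda>k. m ^ k / fact k * exp (- m)) sums (exp m * exp (- m))"
    using sums_mult2[OF exp_converges[of m], of "exp (- m)"] by (simp add: scaleR_conv_of_real field_simps)
  ultimately have "prob (\<Union>k. E k) = 1"
    unfolding prob_E using sums_unique2 by (fastforce simp: exp_minus)
  then have AE: "AE \<omega> in M. \<omega> \<in> (\<Union>k. E k)"
    by (subst AE_in_set_eq_1) auto
  have "(\<integral>\<^sup>+\<omega>. (occupancy \<omega> z)\<^sup>2 \<partial>M) = (\<integral>\<^sup>+\<omega>. (\<Sum>k. ennreal ((real k + 1)\<^sup>2) * indicator (E k) \<omega>) \<partial>M)"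
  proof (rule nn_integral_cong_AE, use AE in eventually_elim)
    fix \<omega> assume "\<omega> \<in> (\<Union>k. E k)"
    then obtain k where k: "\<omega> \<in> E k" by auto
    have "(\<Sum>j. ennreal ((real j + 1)\<^sup>2) * indicator (E j) \<omega>) = (\<Sum>j\<in>{k}. ennreal ((real j + 1)\<^sup>2) * indicator (E j) \<omega>)"
      using k by (intro suminf_finite) (auto simp: E_def split: split_indicator)
    also have "\<dots> = ennreal (real k + 1) ^ 2"
      using k by (simp add: ennreal_power del: ennreal_plus)
    also have "ennreal (real k + 1) = occupancy \<omega> z"
      using k by (simp add: occupancy_def E_def N_def ennreal_of_nat_eq_real_of_nat)
    finally show "(occupancy \<omega> z)\<^sup>2 = (\<Sum>k. ennreal ((real k + 1)\<^sup>2) * indicator (E k) \<omega>)"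
      by simp
  qed
  also have "\<dots> = (\<Sum>k. ennreal ((real k + 1)\<^sup>2) * emeasure M (E k))"
    by (subst nn_integral_suminf) (auto simp: nn_integral_cmult_indicator)
  also have "\<dots> \<le> (\<Sum>k. ennreal ((4 * m) ^ k / fact k))"
  proof (intro suminf_le summableI)
    fix k :: nat
    have "real k + 1 \<le> 2 ^ k"
      by (induction k) auto
    then have "(real k + 1)\<^sup>2 \<le> (2 ^ k)\<^sup>2" by (intro power_mono) auto
    also have "\<dots> = (4::real) ^ k" by (simp add: power_mult[symmetric] power2_eq_square power_mult_distrib[symmetric])
    finally have "(real k + 1)\<^sup>2 * (m ^ k / fact k * exp (- m)) \<le> 4 ^ k * (m ^ k / fact k * 1)"
      using m by (intro mult_mono) auto
    then show "ennreal ((real k + 1)\<^sup>2) * emeasure M (E k) \<le> ennreal ((4 * m) ^ k / fact k)"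
      by (simp add: emeasure_eq_measure prob_E ennreal_mult[symmetric] m power_mult_distrib ennreal_leI)
  qed
  also have "\<dots> = ennreal (exp (4 * m))"
    using exp_converges[of "4 * m"] m
    by (intro suminf_ennreal_eq) (auto simp: scaleR_conv_of_real field_simps)
  also have "\<dots> \<le> occupancy_moment"
    unfolding occupancy_moment_def using m by (intro ennreal_leI) (simp add: mult.assoc)
  finally show ?thesis .
qed

text \<open>
  This is where distinctness of the cells matters: it makes the counts independent and
  keeps the power of each count at two, so that the bound is exponential in the length.
\<close>

lemma nn_integral_link_prod_le:
  assumes "distinct ys"
  shows "(\<integral>\<^sup>+\<omega>. link_prod (occupancy \<omega>) ys \<partial>M) \<le> occupancy_moment ^ length ys"
proof -
  let ?B = "\<lambda>k. cell -` {ys ! k}"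
  have "indep_vars (\<lambda>_. borel) (\<lambda>k \<omega>. pt_count (\<lambda>i. XM i \<omega>) (?B k)) {..<length ys}"
  proof -
    have "disjoint_family_on ?B {..<length ys}"
      using assms by (auto simp: disjoint_family_on_def nth_eq_iff_index_eq)
    then show ?thesis
      by (intro poisson[unfolded stationary_poisson_process_def, THEN conjunct2, THEN conjunct2, rule_format])
        (auto simp: bounded_cell)
  qed
  then have "indep_vars (\<lambda>_. borel) (\<lambda>k \<omega>. (pt_count (\<lambda>i. XM i \<omega>) (?B k) + 1)\<^sup>2) {..<length ys}"
    by (rule indep_vars_compose2[where Y = "\<lambda>_ x. (x + 1)\<^sup>2"]) measurable
  then have ind: "indep_vars (\<lambda>_. borel) (\<lambda>k \<omega>. (occupancy \<omega> (ys ! k))\<^sup>2) {..<length ys}"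
    by (simp add: occupancy_def)
  have "(\<integral>\<^sup>+\<omega>. link_prod (occupancy \<omega>) ys \<partial>M) \<le> (\<integral>\<^sup>+\<omega>. (\<Prod>y\<leftarrow>ys. (occupancy \<omega> y)\<^sup>2) \<partial>M)"
    by (intro nn_integral_mono link_prod_le) (simp add: occupancy_def)
  also have "\<dots> = (\<Prod>k<length ys. \<integral>\<^sup>+\<omega>. (occupancy \<omega> (ys ! k))\<^sup>2 \<partial>M)"
    unfolding prod_list_nth by (intro indep_vars_nn_integral ind) auto
  also have "\<dots> \<le> (\<Prod>k<length ys. occupancy_moment)"
    by (intro prod_mono_ennreal) (simp add: nn_integral_occupancy_sq_le)
  finally show ?thesis by simp
qed

section \<open>Fast propagation is unlikely\<close>

text \<open>
  The event that some loop-free trace gets from \<open>z0\<close> as far as \<open>D\<close> within \<open>n\<close> time steps.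
\<close>

definition far_trace :: "int \<times> int \<Rightarrow> nat \<Rightarrow> real \<Rightarrow> 'a set" where
  "far_trace z0 n D = {\<omega>\<in>space M. \<exists>ys. distinct ys \<and> D \<le> cell_dist z0 (hd ys)
     \<and> 1 \<le> trace_weight (crossings \<omega>) z0 n ys}"

lemma far_trace_sets [measurable]: "far_trace z0 n D \<in> sets M"
proof -
  have [measurable]: "(\<lambda>\<omega>. trace_weight (crossings \<omega>) z0 n ys) \<in> borel_measurable M" for ys
    using past_measurable_M[OF trace_weight_past] .
  show ?thesis unfolding far_trace_def by measurable
qed

text \<open>
  The first moment bound. A trace that gets as far as \<open>D\<close> satisfies
  \<open>1 \<le> exp (- D) * exp (cell_dist z0 (hd ys))\<close>, and the second factor is
  submultiplicative along the trace, so \<open>trace_weight_sum_le\<close> applies.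
\<close>

lemma emeasure_far_trace_le:
  assumes H: "\<And>y. (\<integral>\<^sup>+z. jump_bound y z * ennreal (exp (cell_dist y z)) \<partial>count_space UNIV) \<le> H"
  shows "emeasure M (far_trace z0 n D)
    \<le> ennreal (exp (- D)) * (occupancy_moment * (1 + occupancy_moment * H) ^ n)"
proof -
  let ?S = "{ys. distinct ys \<and> D \<le> cell_dist z0 (hd ys)}"
  let ?b = "\<lambda>y z. ennreal (exp (cell_dist y z))"
  have [measurable]: "(\<lambda>\<omega>. trace_weight (crossings \<omega>) z0 n ys) \<in> borel_measurable M" for ys
    using past_measurable_M[OF trace_weight_past] .
  have "emeasure M (far_trace z0 n D) = (\<integral>\<^sup>+\<omega>. indicator (far_trace z0 n D) \<omega> \<partial>M)" by simp
  also have "\<dots> \<le> (\<integral>\<^sup>+\<omega>. \<integral>\<^sup>+ys. of_bool (ys \<in> ?S) * trace_weight (crossings \<omega>) z0 n ys \<partial>count_space UNIV \<partial>M)"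
  proof (intro nn_integral_mono)
    fix \<omega>
    show "indicator (far_trace z0 n D) \<omega>
        \<le> (\<integral>\<^sup>+ys. of_bool (ys \<in> ?S) * trace_weight (crossings \<omega>) z0 n ys \<partial>count_space UNIV)"
    proof (cases "\<omega> \<in> far_trace z0 n D")
      case True
      then obtain ys where ys: "ys \<in> ?S" "1 \<le> trace_weight (crossings \<omega>) z0 n ys"
        by (auto simp: far_trace_def)
      have "1 \<le> of_bool (ys \<in> ?S) * trace_weight (crossings \<omega>) z0 n ys" using ys by simp
      also have "\<dots> \<le> (\<integral>\<^sup>+ys. of_bool (ys \<in> ?S) * trace_weight (crossings \<omega>) z0 n ys \<partial>count_space UNIV)"
        by (rule nn_integral_ge_point) simp
      finally show ?thesis using True by simp
    qed simp
  qed
  also have "\<dots> = (\<integral>\<^sup>+ys. \<integral>\<^sup>+\<omega>. of_bool (ys \<in> ?S) * trace_weight (crossings \<omega>) z0 n ys \<partial>M \<partial>count_space UNIV)"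
    by (rule nn_integral_count_space_nn_integral) auto
  also have "\<dots> \<le> (\<integral>\<^sup>+ys. ennreal (exp (- D)) * (trace_weight (\<lambda>_. jump_bound) z0 n ys
      * occupancy_moment ^ length ys * ?b z0 (hd ys)) \<partial>count_space UNIV)"
  proof (intro nn_integral_mono)
    fix ys :: "(int \<times> int) list"
    show "(\<integral>\<^sup>+\<omega>. of_bool (ys \<in> ?S) * trace_weight (crossings \<omega>) z0 n ys \<partial>M)
        \<le> ennreal (exp (- D)) * (trace_weight (\<lambda>_. jump_bound) z0 n ys
          * occupancy_moment ^ length ys * ?b z0 (hd ys))"
    proof (cases "ys \<in> ?S")
      case True
      have "(\<integral>\<^sup>+\<omega>. of_bool (ys \<in> ?S) * trace_weight (crossings \<omega>) z0 n ys \<partial>M)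
          = (\<integral>\<^sup>+\<omega>. trace_weight (crossings \<omega>) z0 n ys * 1 \<partial>M)"
        using True by simp
      also have "\<dots> \<le> trace_weight (\<lambda>_. jump_bound) z0 n ys * (\<integral>\<^sup>+\<omega>. 1 * link_prod (occupancy \<omega>) ys \<partial>M)"
        by (rule nn_integral_trace_weight_le) simp
      also have "\<dots> \<le> trace_weight (\<lambda>_. jump_bound) z0 n ys * occupancy_moment ^ length ys"
        using True by (intro mult_left_mono) (auto intro: nn_integral_link_prod_le)
      also have "\<dots> \<le> (trace_weight (\<lambda>_. jump_bound) z0 n ys * occupancy_moment ^ length ys)
          * (ennreal (exp (- D)) * ?b z0 (hd ys))"
      proof -
        have "ennreal 1 \<le> ennreal (exp (- D) * exp (cell_dist z0 (hd ys)))"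
          using True by (intro ennreal_leI) (simp add: mult_exp_exp)
        then have "1 \<le> ennreal (exp (- D)) * ?b z0 (hd ys)" by (simp add: ennreal_mult)
        from mult_left_mono[OF this] show ?thesis by fastforce
      qed
      finally show ?thesis by (simp add: ac_simps)
    next
      case False
      then have "of_bool (ys \<in> ?S) = (0 :: ennreal)" by simp
      then show ?thesis by (simp only: mult_zero_left nn_integral_0_iff_AE) simp
    qed
  qed
  also have "\<dots> = ennreal (exp (- D)) * (\<integral>\<^sup>+ys. trace_weight (\<lambda>_. jump_bound) z0 n ys
      * occupancy_moment ^ length ys * ?b z0 (hd ys) \<partial>count_space UNIV)"
    by (rule nn_integral_cmult) simp
  also have "\<dots> \<le> ennreal (exp (- D)) * (occupancy_moment * (1 + occupancy_moment * H) ^ n)"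
  proof (intro mult_left_mono trace_weight_sum_le H)
    show "?b y y = 1" for y by (simp add: cell_dist_def)
    show "?b x z \<le> ?b x y * ?b y z" for x y z
      using cell_dist_triangle[of x z y]
      by (subst ennreal_mult[symmetric]) (auto intro!: ennreal_leI simp: mult_exp_exp)
  qed auto
  finally show ?thesis .
qed

section \<open>From paths of the graph to traces\<close>

abbreviation sinr_edges :: "'a \<Rightarrow> ((pidx \<times> int) \<times> (pidx \<times> int)) set" where
  "sinr_edges \<omega> \<equiv> sinr_graph (power_path_loss A \<beta>) T (\<lambda>i. X i \<omega>) (\<lambda>i n. e i n \<omega>)
     (\<lambda>i n. W i n \<omega>) (\<lambda>i j n. F i j n \<omega>)"

abbreviation delay :: "real^2 \<Rightarrow> real^2 \<Rightarrow> 'a \<Rightarrow> ennreal" where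
  "delay x y \<omega> \<equiv> path_length (power_path_loss A \<beta>) T (\<lambda>i. X i \<omega>) (\<lambda>i n. e i n \<omega>)
     (\<lambda>i n. W i n \<omega>) (\<lambda>i j n. F i j n \<omega>) x y 0"

abbreviation nearest :: "real^2 \<Rightarrow> 'a \<Rightarrow> pidx" where
  "nearest x \<omega> \<equiv> closest (\<lambda>i. X i \<omega>) x"

lemma AE_noise_constant: "AE \<omega> in M. \<forall>i n. W i n \<omega> = w0"
proof -
  have "AE \<omega> in M. W i n \<omega> = w0" for i n
  proof -
    have "AE r in distr M borel (W i n). r = w0"
      unfolding W_law LW_constant by (subst AE_return) auto
    then show ?thesis
      using W_measurable by (subst (asm) AE_distr_iff) auto
  qed
  then show ?thesis by (simp add: AE_all_countable)
qed

text \<open>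
  Strictness comes from the half-open cells. It makes the fading of a successful jump strictly larger
  than the threshold.
\<close>

lemma cell_dist_less: "s * (real_of_int (cell_dist (cell x) (cell y)) - 1) < norm (x - y)"
proof -
  have "s * (real_of_int \<bar>\<lfloor>y $ k / s\<rfloor> - \<lfloor>x $ k / s\<rfloor>\<bar> - 1) < norm (x - y)" for k
  proof -
    have "real_of_int \<bar>\<lfloor>y $ k / s\<rfloor> - \<lfloor>x $ k / s\<rfloor>\<bar> - 1 < \<bar>y $ k / s - x $ k / s\<bar>"
      by linarith
    also have "\<dots> = \<bar>(x - y) $ k\<bar> / s"
      using s_pos by (simp add: diff_divide_distrib[symmetric] abs_minus_commute)
    also have "\<dots> \<le> norm (x - y) / s"
      using s_pos component_le_norm_cart[of "x - y" k] by (simp add: divide_right_mono)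
    finally show ?thesis using s_pos by (simp add: field_simps)
  qed
  then show ?thesis by (auto simp: cell_dist_def cell_def max_def)
qed

text \<open>
  Interference can only lower the ratio, so success forces the received power above \<open>T * w0\<close>. The
  path loss is then positive, since division by zero would give a vanishing ratio.
\<close>

lemma success_imp_fading_gt:
  assumes noise: "W j n \<omega> = w0"
    and suc: "success (power_path_loss A \<beta>) T (\<lambda>i. X i \<omega>) (\<lambda>i n. e i n \<omega>)
      (\<lambda>i n. W i n \<omega>) (\<lambda>i j n. F i j n \<omega>) i j n"
    and cells: "cell (X i \<omega>) \<noteq> cell (X j \<omega>)"
  shows "fading_threshold (cell (X i \<omega>)) (cell (X j \<omega>)) < F i j n \<omega>"
proof -
  let ?r = "norm (X i \<omega> - X j \<omega>)"
  let ?k = "real_of_int (cell_dist (cell (X i \<omega>)) (cell (X j \<omega>)))"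
  define l where "l = (A * ?r) powr \<beta>"
  define I where "I = interference (power_path_loss A \<beta>) (\<lambda>i. X i \<omega>) (\<lambda>i n. e i n \<omega>) (\<lambda>i j n. F i j n \<omega>) i j n"
  have T: "ennreal T \<le> ennreal (F i j n \<omega> / l) / (ennreal w0 + I)"
    using suc cells unfolding success_def sinr_def I_def l_def power_path_loss_def noise by auto
  have "T * w0 \<le> F i j n \<omega> / l"
  proof (cases I)
    case (real r)
    show ?thesis
    proof (cases "0 \<le> F i j n \<omega> / l")
      case True
      then have "ennreal T \<le> ennreal (F i j n \<omega> / l / (w0 + r))"
        using T real w0_pos by (simp add: divide_ennreal ennreal_plus[symmetric] del: ennreal_plus)
      then have "T \<le> F i j n \<omega> / l / (w0 + r)"
        using T_pos by (simp add: ennreal_le_iff2)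
      then have "T * (w0 + r) \<le> F i j n \<omega> / l"
        using w0_pos real by (intro pos_le_divide_eq[THEN iffD1]) auto
      moreover have "T * w0 \<le> T * (w0 + r)" using T_pos real by simp
      ultimately show ?thesis by simp
    next
      case False
      then show ?thesis using T T_pos by (simp add: ennreal_neg)
    qed
  next
    case top
    then show ?thesis using T T_pos by simp
  qed
  moreover have "0 < T * w0" using T_pos w0_pos by simp
  moreover have "0 \<le> l" by (simp add: l_def)
  ultimately have F: "T * w0 * l \<le> F i j n \<omega>"
    by (cases "l = 0") (auto simp: pos_le_divide_eq)
  have "1 \<le> cell_dist (cell (X i \<omega>)) (cell (X j \<omega>))"
    using cells unfolding cell_dist_def
    by (cases "cell (X i \<omega>)"; cases "cell (X j \<omega>)") (auto simp: max_def)
  then have "(A * (s * (?k - 1))) powr \<beta> < l"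
    unfolding l_def using A_pos s_pos \<beta>_gt_2 cell_dist_less[of "X i \<omega>" "X j \<omega>"]
    by (intro powr_less_mono2 mult_strict_left_mono) auto
  then have "fading_threshold (cell (X i \<omega>)) (cell (X j \<omega>)) < T * w0 * l"
    unfolding fading_threshold_def using T_pos w0_pos by simp
  then show ?thesis using F by simp
qed

definition jump_possible :: "'a \<Rightarrow> nat \<Rightarrow> int \<times> int \<Rightarrow> int \<times> int \<Rightarrow> bool" where
  "jump_possible \<omega> n y z \<longleftrightarrow>
     (\<exists>i j. cell (X i \<omega>) = y \<and> cell (X j \<omega>) = z \<and> fading_threshold y z < F i j (int n) \<omega>)"

lemma jump_possible_crossings: "jump_possible \<omega> n y z \<Longrightarrow> 1 \<le> crossings \<omega> n y z"
proof -
  assume "jump_possible \<omega> n y z"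
  then obtain i j where ij: "cell (X i \<omega>) = y" "cell (X j \<omega>) = z" "fading_threshold y z < F i j (int n) \<omega>"
    by (auto simp: jump_possible_def)
  let ?f = "\<lambda>(i, j). of_bool (cell (X i \<omega>) = y) * of_bool (cell (X j \<omega>) = z)
     * of_bool (fading_threshold y z < F i j (int n) \<omega>) :: ennreal"
  have "1 = ?f (i, j)" using ij by simp
  also have "\<dots> \<le> (\<integral>\<^sup>+p. ?f p \<partial>count_space UNIV)" by (rule nn_integral_ge_point) simp
  finally show ?thesis by (simp add: crossings_def)
qed

lemma path_imp_jump_trace:
  assumes noise: "\<forall>i n. W i n \<omega> = w0"
  shows "((i, 0), (j, m)) \<in> sinr_edges \<omega> ^^ k \<Longrightarrow> m = int k \<and>
    (\<exists>ys. jump_trace (jump_possible \<omega>) (cell (X i \<omega>)) k ys \<and> distinct ys \<and> hd ys = cell (X j \<omega>))"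
proof (induction k arbitrary: j m)
  case 0
  then show ?case by (auto intro: jump_trace.start)
next
  case (Suc k)
  then obtain j' m' where path: "((i, 0), (j', m')) \<in> sinr_edges \<omega> ^^ k"
    and edge: "((j', m'), (j, m)) \<in> sinr_edges \<omega>"
    by (auto elim: relpow_Suc_E)
  obtain ys where m': "m' = int k" and ys: "jump_trace (jump_possible \<omega>) (cell (X i \<omega>)) k ys"
    "distinct ys" "hd ys = cell (X j' \<omega>)"
    using Suc.IH[OF path] by auto
  have m: "m = m' + 1" and suc: "success (power_path_loss A \<beta>) T (\<lambda>i. X i \<omega>) (\<lambda>i n. e i n \<omega>)
      (\<lambda>i n. W i n \<omega>) (\<lambda>i j n. F i j n \<omega>) j' j (int k)"
    using edge m' by (auto simp: sinr_graph_def)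
  have "cell (X j \<omega>) = hd ys \<or> jump_possible \<omega> k (hd ys) (cell (X j \<omega>))"
  proof (cases "cell (X j' \<omega>) = cell (X j \<omega>)")
    case False
    have "fading_threshold (cell (X j' \<omega>)) (cell (X j \<omega>)) < F j' j (int k) \<omega>"
      using noise by (intro success_imp_fading_gt[OF _ suc False]) simp
    then show ?thesis unfolding jump_possible_def ys(3) by blast
  qed (simp add: ys(3))
  from distinct_jump_trace_step[OF ys(1,2) this] show ?case using m m' by simp
qed

text \<open>
  A path of fewer than \<open>n\<close> edges could be prolonged by waiting to a trace up to time \<open>n\<close>,
  and would cover at least the distance \<open>D\<close>.
\<close>

lemma delay_ge:
  assumes noise: "\<forall>i n. W i n \<omega> = w0" and "\<omega> \<in> space M"
    and near: "\<omega> \<notin> far_trace (cell (X (nearest x \<omega>) \<omega>)) n D"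
    and far: "D \<le> cell_dist (cell (X (nearest x \<omega>) \<omega>)) (cell (X (nearest y \<omega>) \<omega>))"
  shows "of_nat n \<le> delay x y \<omega>"
  unfolding path_length_def
proof (rule INF_greatest)
  fix k assume "k \<in> {k. \<exists>m\<ge>1. ((nearest x \<omega>, 0), (nearest y \<omega>, 0 + m)) \<in> sinr_edges \<omega> ^^ k}"
  then obtain ys where ys: "jump_trace (jump_possible \<omega>) (cell (X (nearest x \<omega>) \<omega>)) k ys"
    "distinct ys" "hd ys = cell (X (nearest y \<omega>) \<omega>)"
    using path_imp_jump_trace[OF noise] by blast
  show "of_nat n \<le> (of_nat k :: ennreal)"
  proof (rule ccontr)
    assume "\<not> of_nat n \<le> (of_nat k :: ennreal)"
    then have "n = k + (n - k)" by simp
    then have "jump_trace (jump_possible \<omega>) (cell (X (nearest x \<omega>) \<omega>)) n ys"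
      using jump_trace_mono[OF ys(1), of "n - k"] by simp
    then have "1 \<le> trace_weight (crossings \<omega>) (cell (X (nearest x \<omega>) \<omega>)) n ys"
      using jump_possible_crossings by (rule trace_weight_ge_1)
    then show False using near far ys \<open>\<omega> \<in> space M\<close> by (auto simp: far_trace_def)
  qed
qed

section \<open>The nearest point when the Poisson part leaves a hole\<close>

text \<open>
  No coordinate of \<open>x\<close> lies exactly half-way between two lines of the grid, so that \<open>x\<close> has a
  unique nearest grid point.
\<close>

definition grid_tie_free :: "real^2 \<Rightarrow> real^2 \<Rightarrow> bool" where
  "grid_tie_free x u \<longleftrightarrow> (\<forall>k. \<forall>m::int. (x $ k - u $ k) / s + 1 / 2 \<noteq> of_int m)"

text \<open>
  Ties confine the shift \<open>U\<close> to countably many lines, a null set for its uniform law.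
\<close>

lemma AE_grid_tie_free: "AE \<omega> in M. grid_tie_free x (U \<omega>)"
proof -
  have "AE u in lborel. (x $ k - u $ k) / s + 1 / 2 \<noteq> of_int m" for k and m :: int
  proof -
    let ?N = "{u :: real^2. u $ k = x $ k - s * (of_int m - 1 / 2)}"
    have "closed ?N" by (intro closed_Collect_eq continuous_intros)
    then have "?N \<in> null_sets lborel"
      using negligible_hyperplane[of "axis k 1 :: real^2" "x $ k - s * (of_int m - 1 / 2)"]
      by (simp add: negligible_iff_null_sets null_sets_completion_iff inner_axis')
    then show ?thesis
    proof (rule AE_I')
      show "{u \<in> space lborel. \<not> (x $ k - u $ k) / s + 1 / 2 \<noteq> of_int m} \<subseteq> ?N"
        using s_pos by (auto simp: field_simps)
    qed
  qed
  then have "AE u in lborel. grid_tie_free x u"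
    unfolding grid_tie_free_def by (simp add: AE_all_countable)
  then have "AE u in distr M lborel U. grid_tie_free x u"
    unfolding U_uniform by (intro AE_uniform_measureI) auto
  then show ?thesis
    using U_measurable by (intro AE_distrD[of U M lborel]) auto
qed

text \<open>
  Rounding each coordinate gives a grid point at distance at most \<open>s / sqrt 2 < s\<close>. It is strictly closer than
  all other grid points, coordinate by coordinate, and than the Poisson points, which are at distance
  \<open>s\<close> or more. So the nearest point is well defined and close to \<open>x\<close>.
\<close>

lemma dist_nearest_less:
  assumes tie: "grid_tie_free x (U \<omega>)" and void: "\<And>k. XM k \<omega> \<notin> ball x s"
  shows "dist x (X (nearest x \<omega>) \<omega>) < s"
proof -
  \<comment> \<open>Coordinatewise offset of \<open>x\<close> from the grid line with number \<open>a\<close>; \<open>c k\<close> is the nearest line.\<close>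
  define off where "off = (\<lambda>k (a::int). x $ k - U \<omega> $ k - s * a)"
  define c where "c = (\<lambda>k. \<lfloor>(x $ k - U \<omega> $ k) / s + 1 / 2\<rfloor>)"
  have c_less: "\<bar>off k (c k)\<bar> < s / 2" for k
  proof -
    define v where "v = (x $ k - U \<omega> $ k) / s"
    have "v + 1 / 2 \<noteq> of_int (c k)" using tie by (simp add: grid_tie_free_def v_def)
    then have "\<bar>v - c k\<bar> < 1 / 2" unfolding c_def v_def[symmetric] by linarith
    moreover have "off k (c k) = s * (v - c k)" using s_pos by (simp add: off_def v_def field_simps)
    ultimately show ?thesis using s_pos by (simp add: abs_mult)
  qed
  have c_gt: "s / 2 < \<bar>off k a\<bar>" if "a \<noteq> c k" for k a
  proof -
    have "off k a = off k (c k) + s * real_of_int (c k - a)" by (simp add: off_def algebra_simps)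
    moreover have "s * 1 \<le> s * \<bar>real_of_int (c k - a)\<bar>"
      using that s_pos by (intro mult_left_mono) linarith+
    then have "s \<le> \<bar>s * real_of_int (c k - a)\<bar>" using s_pos by (simp add: abs_mult)
    ultimately show ?thesis using c_less[of k] by linarith
  qed
  have sq_less: "(off k (c k))\<^sup>2 < (off k a)\<^sup>2" if "a \<noteq> c k" for k a
    using power_strict_mono[of "\<bar>off k (c k)\<bar>" "\<bar>off k a\<bar>" 2] c_less[of k] c_gt[OF that] by simp
  have dist_grid: "dist x (X (Inr (a, b)) \<omega>) = sqrt ((off 1 a)\<^sup>2 + (off 2 b)\<^sup>2)" for a b
    by (simp add: dist_vec_def L2_set_def UNIV_2 poisson_grid_def off_def dist_real_def algebra_simps)
  let ?i = "Inr (c 1, c 2) :: pidx"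
  have near: "dist x (X ?i \<omega>) < s"
  proof -
    have "(off k (c k))\<^sup>2 \<le> (s / 2)\<^sup>2" for k
      using c_less[of k] s_pos by (intro abs_le_square_iff[THEN iffD1]) auto
    from add_mono[OF this[of 1] this[of 2]]
    have "(off 1 (c 1))\<^sup>2 + (off 2 (c 2))\<^sup>2 \<le> s\<^sup>2 / 2"
      by (simp add: power_divide)
    also have "\<dots> < s\<^sup>2" using s_pos by simp
    finally have "(off 1 (c 1))\<^sup>2 + (off 2 (c 2))\<^sup>2 < s\<^sup>2" .
    then show ?thesis unfolding dist_grid using s_pos real_sqrt_less_mono by fastforce
  qed
  have "dist x (X ?i \<omega>) < dist x (X j \<omega>)" if "j \<noteq> ?i" for j
  proof (cases j)
    case (Inl k)
    then have "s \<le> dist x (X j \<omega>)" using void[of k] by (simp add: poisson_grid_def)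
    then show ?thesis using near by simp
  next
    case (Inr g)
    obtain a b where j: "j = Inr (a, b)" using Inr by (cases g) auto
    then have "a \<noteq> c 1 \<or> b \<noteq> c 2" using that by auto
    then have "(off 1 (c 1))\<^sup>2 + (off 2 (c 2))\<^sup>2 < (off 1 a)\<^sup>2 + (off 2 b)\<^sup>2"
      using sq_less[of a 1] sq_less[of b 2]
      by (cases "a = c 1"; cases "b = c 2") (auto intro: add_strict_mono)
    then show ?thesis unfolding j dist_grid by simp
  qed
  then have "nearest x \<omega> = ?i"
    unfolding closest_def by (intro the_equality) (blast, metis less_asym)
  then show ?thesis using near by simp
qed

definition void_event :: "(real^2) set \<Rightarrow> 'a set" where
  "void_event B = {\<omega>\<in>space M. \<forall>k. XM k \<omega> \<notin> B}"

lemma void_event_sets [measurable]: "B \<in> sets borel \<Longrightarrow> void_event B \<in> sets M"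
  unfolding void_event_def
proof -
  assume [measurable]: "B \<in> sets borel"
  show "{\<omega> \<in> space M. \<forall>k. XM k \<omega> \<notin> B} \<in> sets M" by measurable
qed

lemma prob_void_event:
  assumes "B \<in> sets borel" "bounded B"
  shows "prob (void_event B) = exp (- (lam * measure lborel B))"
proof -
  have "pt_count (\<lambda>k. XM k \<omega>) B = of_nat 0 \<longleftrightarrow> (\<forall>k. XM k \<omega> \<notin> B)" for \<omega>
    by (auto simp: pt_count_def emeasure_count_space_eq_0)
  then show ?thesis
    using poisson[unfolded stationary_poisson_process_def, THEN conjunct2, THEN conjunct1,
        rule_format, OF assms, of 0]
    by (simp add: void_event_def)
qed

text \<open>
  The bound is the same for all positions of the two balls, in particular as \<open>y\<close> moves to infinity.
\<close>

lemma prob_void_two_balls: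
  "exp (- (2 * lam * measure lborel (ball (0 :: real^2) s))) \<le> prob (void_event (ball x s \<union> ball y s))"
proof -
  have "measure lborel (ball x s \<union> ball y s)
      \<le> measure lborel (ball x s) + measure lborel (ball y s)"
    by (intro measure_Un_le) auto
  also have "\<dots> = 2 * measure lborel (ball (0 :: real^2) s)"
    using s_pos content_ball[of s x] content_ball[of s y] content_ball[of s "0::real^2"] by simp
  finally have "lam * measure lborel (ball x s \<union> ball y s) \<le> 2 * lam * measure lborel (ball (0 :: real^2) s)"
    using lam_pos by simp
  then show ?thesis by (subst prob_void_event) auto
qed

lemma cell_near_origin:
  assumes "dist 0 x < s"
  shows "cell x \<in> {-1, 0} \<times> {-1, 0}"
proof -
  have "\<lfloor>x $ k / s\<rfloor> \<in> {-1, 0}" for k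
  proof -
    have "\<bar>x $ k\<bar> < s" using assms component_le_norm_cart[of x k] by simp
    then have "- s < x $ k" "x $ k < s" by linarith+
    then have "- 1 < x $ k / s" "x $ k / s < 1" using s_pos by (simp_all add: field_simps)
    then have "\<lfloor>x $ k / s\<rfloor> = - 1 \<or> \<lfloor>x $ k / s\<rfloor> = 0" by linarith
    then show ?thesis by auto
  qed
  then show ?thesis unfolding cell_def by blast
qed

text \<open>
  Some coordinate of a planar unit vector is at least \<open>1 / 2\<close> in absolute value.
\<close>

lemma cell_dist_far:
  assumes d: "norm d = 1" and t: "0 \<le> t" and x: "dist 0 x < s" and y: "dist (t *\<^sub>R d) y < s"
  shows "t / (2 * s) - 3 \<le> cell_dist (cell x) (cell y)"
proof -
  have "\<exists>k. 1 / 2 \<le> \<bar>d $ k\<bar>"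
  proof (rule ccontr)
    assume "\<not> ?thesis"
    then have "\<bar>d $ 1\<bar> < 1 / 2" "\<bar>d $ 2\<bar> < 1 / 2" by (auto simp: not_le)
    then show False using d norm_le_l1_cart[of d] by (simp add: UNIV_2)
  qed
  then obtain k where k: "1 / 2 \<le> \<bar>d $ k\<bar>" by blast
  have "\<bar>x $ k\<bar> < s" using x component_le_norm_cart[of x k] by simp
  moreover have "\<bar>t * d $ k - y $ k\<bar> < s"
    using y component_le_norm_cart[of "t *\<^sub>R d - y" k] by (simp add: dist_norm)
  moreover have "t / 2 \<le> \<bar>t * d $ k\<bar>"
    using mult_left_mono[OF k t] t by (simp add: abs_mult)
  ultimately have "t / 2 - 2 * s \<le> \<bar>y $ k - x $ k\<bar>" by linarith
  then have "(t / 2 - 2 * s) / s \<le> \<bar>y $ k - x $ k\<bar> / s"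
    using s_pos by (simp add: divide_right_mono)
  then have "t / (2 * s) - 2 \<le> \<bar>y $ k / s - x $ k / s\<bar>"
    using s_pos by (simp add: diff_divide_distrib[symmetric] field_simps)
  also have "\<dots> \<le> real_of_int \<bar>\<lfloor>y $ k / s\<rfloor> - \<lfloor>x $ k / s\<rfloor>\<bar> + 1" by linarith
  also have "\<bar>\<lfloor>y $ k / s\<rfloor> - \<lfloor>x $ k / s\<rfloor>\<bar> \<le> cell_dist (cell x) (cell y)"
    using exhaust_2[of k] by (auto simp: cell_dist_def cell_def)
  finally show ?thesis by simp
qed

section \<open>Measurability of the delay\<close>

lemma success_measurable [measurable]:
  "Measurable.pred M (\<lambda>\<omega>. success (power_path_loss A \<beta>) T (\<lambda>i. X i \<omega>) (\<lambda>i n. e i n \<omega>)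
    (\<lambda>i n. W i n \<omega>) (\<lambda>i j n. F i j n \<omega>) i j n)"
proof -
  note [measurable] = e_measurable W_measurable F_measurable
  have [measurable]: "(\<lambda>\<omega>. power_path_loss A \<beta> (norm (X i \<omega> - X j \<omega>))) \<in> borel_measurable M" for i j
    unfolding power_path_loss_def by measurable
  have [measurable]: "(\<lambda>\<omega>. interference (power_path_loss A \<beta>) (\<lambda>i. X i \<omega>) (\<lambda>i n. e i n \<omega>)
      (\<lambda>i j n. F i j n \<omega>) i j n) \<in> borel_measurable M"
    unfolding interference_def by (rule measurable_infsum_ennreal) measurable
  show ?thesis unfolding success_def sinr_def by measurable
qed

lemma path_measurable [measurable]:
  "Measurable.pred M (\<lambda>\<omega>. ((i, n), (j, m)) \<in> sinr_edges \<omega> ^^ k)"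
proof (induction k arbitrary: j m)
  case (Suc k)
  note [measurable] = Suc.IH
  have "((i, n), (j, m)) \<in> sinr_edges \<omega> ^^ Suc k \<longleftrightarrow>
      (\<exists>j' m'. ((i, n), (j', m')) \<in> sinr_edges \<omega> ^^ k \<and> m = m' + 1 \<and>
        success (power_path_loss A \<beta>) T (\<lambda>i. X i \<omega>) (\<lambda>i n. e i n \<omega>)
          (\<lambda>i n. W i n \<omega>) (\<lambda>i j n. F i j n \<omega>) j' j m')" for \<omega>
    by (auto simp: sinr_graph_def relcomp_unfold)
  then show ?case by simp
qed simp

lemma nearest_measurable [measurable]: "nearest x \<in> measurable M (count_space UNIV)"
  unfolding closest_def
proof (rule measurable_THE[where I = UNIV])
  show "Measurable.pred M (\<lambda>\<omega>. \<forall>j. j \<noteq> i \<longrightarrow> dist x (X i \<omega>) < dist x (X j \<omega>))" for i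
    by measurable
  show "i = j" if "\<forall>j. j \<noteq> i \<longrightarrow> dist x (X i \<omega>) < dist x (X j \<omega>)"
      "\<forall>i. i \<noteq> j \<longrightarrow> dist x (X j \<omega>) < dist x (X i \<omega>)" for \<omega> i j
    using that less_asym by blast
qed auto

text \<open>
  Measurability of the delay is more than a formality: \<open>nn_cond_exp\<close> of a function that is not measurable
  is zero.
\<close>

lemma delay_measurable [measurable]: "delay x y \<in> borel_measurable M"
proof -
  have "delay x y \<omega> = (INF k. if \<exists>m i j. 1 \<le> m \<and> nearest x \<omega> = i \<and> nearest y \<omega> = j
      \<and> ((i, 0), (j, m)) \<in> sinr_edges \<omega> ^^ k then of_nat k else top)" for \<omega>
  proof -
    let ?S = "{k. \<exists>m\<ge>1. ((nearest x \<omega>, 0), (nearest y \<omega>, 0 + m)) \<in> sinr_edges \<omega> ^^ k}"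
    have "(INF k\<in>?S. of_nat k) = (INF k. if k \<in> ?S then of_nat k else top :: ennreal)"
    proof (rule antisym)
      show "(INF k. if k \<in> ?S then of_nat k else top :: ennreal) \<le> (INF k\<in>?S. of_nat k)"
      proof (rule INF_greatest)
        fix k assume "k \<in> ?S"
        then show "(INF k. if k \<in> ?S then of_nat k else top :: ennreal) \<le> of_nat k"
          by (intro INF_lower2[of k]) auto
      qed
      show "(INF k\<in>?S. of_nat k) \<le> (INF k. if k \<in> ?S then of_nat k else top :: ennreal)"
      proof (rule INF_greatest)
        fix k
        show "(INF k\<in>?S. of_nat k) \<le> (if k \<in> ?S then of_nat k else top :: ennreal)"
          by (cases "k \<in> ?S") (simp_all only: if_True if_False INF_lower top_greatest)
      qed
    qed
    then show ?thesis unfolding path_length_def by simp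
  qed
  moreover have "(\<lambda>\<omega>. INF k. if \<exists>m i j. 1 \<le> m \<and> nearest x \<omega> = i \<and> nearest y \<omega> = j
      \<and> ((i, 0), (j, m)) \<in> sinr_edges \<omega> ^^ k then of_nat k else top :: ennreal) \<in> borel_measurable M"
    by measurable
  ultimately show ?thesis by simp
qed

section \<open>Linear growth of the mean delay\<close>

text \<open>
  On the event that both balls are free of Poisson points, the path starts in one of the four cells
  around the origin and has to cover the distance \<open>t / (2 * s) - 3\<close>, so the delay is at least \<open>n\<close> unless one
  of four far traces occurs.
\<close>

lemma nn_integral_delay_ge:
  assumes d: "norm d = 1" and t: "0 \<le> t"
    and H: "\<And>y. (\<integral>\<^sup>+z. jump_bound y z * ennreal (exp (cell_dist y z)) \<partial>count_space UNIV) \<le> ennreal H"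
    and "0 \<le> H"
  shows "ennreal (real n * (exp (- (2 * lam * measure lborel (ball (0 :: real^2) s)))
      - 4 * (exp (3 - t / (2 * s)) * (exp (4 * lam * s\<^sup>2) * (1 + exp (4 * lam * s\<^sup>2) * H) ^ n))))
    \<le> (\<integral>\<^sup>+\<omega>. delay 0 (t *\<^sub>R d) \<omega> \<partial>M)"
proof -
  let ?D = "t / (2 * s) - 3"
  let ?C = "{-1, 0} \<times> {-1, 0} :: (int \<times> int) set"
  let ?V = "void_event (ball 0 s \<union> ball (t *\<^sub>R d) s)"
  let ?Far = "\<Union>z\<in>?C. far_trace z n ?D"
  let ?r = "exp (3 - t / (2 * s)) * (exp (4 * lam * s\<^sup>2) * (1 + exp (4 * lam * s\<^sup>2) * H) ^ n)"
  have far: "prob (far_trace z n ?D) \<le> ?r" for z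
  proof -
    have "ennreal (prob (far_trace z n ?D)) \<le> ennreal (exp (- ?D)) *
        (occupancy_moment * (1 + occupancy_moment * ennreal H) ^ n)"
      using emeasure_far_trace_le[OF H, of z n ?D] by (simp add: emeasure_eq_measure)
    also have "1 + occupancy_moment * ennreal H = ennreal (1 + exp (4 * lam * s\<^sup>2) * H)"
      using \<open>0 \<le> H\<close> by (simp add: occupancy_moment_def ennreal_mult[symmetric])
    also have "ennreal (exp (- ?D)) * (occupancy_moment * \<dots> ^ n) = ennreal ?r"
      using \<open>0 \<le> H\<close> by (simp add: occupancy_moment_def ennreal_mult ennreal_power del: ennreal_plus)
    finally show ?thesis using \<open>0 \<le> H\<close> by (simp add: ennreal_le_iff)
  qed
  have "prob ?Far \<le> (\<Sum>z\<in>?C. prob (far_trace z n ?D))"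
    by (intro finite_measure_subadditive_finite) auto
  also have "\<dots> \<le> of_nat (card ?C) * ?r"
    by (intro sum_bounded_above far)
  finally have Far: "prob ?Far \<le> 4 * ?r" by simp
  have [measurable]: "?V \<in> sets M" "?Far \<in> sets M"
    by (auto intro: void_event_sets)
  have "exp (- (2 * lam * measure lborel (ball (0 :: real^2) s))) - 4 * ?r \<le> prob ?V - prob ?Far"
    using prob_void_two_balls[of 0 "t *\<^sub>R d"] Far by simp
  also have "\<dots> \<le> prob (?V - ?Far)"
    using finite_measure_mono[of ?V "(?V - ?Far) \<union> ?Far"]
      measure_Un_le[of "?V - ?Far" M ?Far] by auto
  finally have P: "exp (- (2 * lam * measure lborel (ball (0 :: real^2) s))) - 4 * ?r \<le> prob (?V - ?Far)" .
  have "ennreal (real n * (exp (- (2 * lam * measure lborel (ball (0 :: real^2) s))) - 4 * ?r))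
      \<le> ennreal (real n * prob (?V - ?Far))"
    by (intro ennreal_leI mult_left_mono P) simp
  also have "\<dots> = (\<integral>\<^sup>+\<omega>. of_nat n * indicator (?V - ?Far) \<omega> \<partial>M)"
    by (subst nn_integral_cmult_indicator)
      (auto simp: ennreal_mult emeasure_eq_measure ennreal_of_nat_eq_real_of_nat)
  also have "\<dots> \<le> (\<integral>\<^sup>+\<omega>. delay 0 (t *\<^sub>R d) \<omega> \<partial>M)"
  proof (rule nn_integral_mono_AE)
    show "AE \<omega> in M. of_nat n * indicator (?V - ?Far) \<omega> \<le> delay 0 (t *\<^sub>R d) \<omega>"
      using AE_noise_constant AE_grid_tie_free[of 0] AE_grid_tie_free[of "t *\<^sub>R d"]
    proof eventually_elim
      case (elim \<omega>)
      show ?case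
      proof (cases "\<omega> \<in> ?V - ?Far")
        case True
        then have \<omega>: "\<omega> \<in> space M" "\<And>k. XM k \<omega> \<notin> ball 0 s" "\<And>k. XM k \<omega> \<notin> ball (t *\<^sub>R d) s"
          by (auto simp: void_event_def)
        let ?x = "X (nearest 0 \<omega>) \<omega>" and ?y = "X (nearest (t *\<^sub>R d) \<omega>) \<omega>"
        have x: "dist 0 ?x < s" by (rule dist_nearest_less[OF elim(2) \<omega>(2)])
        have y: "dist (t *\<^sub>R d) ?y < s" by (rule dist_nearest_less[OF elim(3) \<omega>(3)])
        have "\<omega> \<notin> ?Far" using True by (rule DiffE)
        then have "\<omega> \<notin> far_trace (cell ?x) n ?D"
          using UN_I[OF cell_near_origin[OF x]] by metis
        from delay_ge[OF elim(1) \<omega>(1) this cell_dist_far[OF d t x y]] True show ?thesis by simp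
      qed simp
    qed
  qed
  finally show ?thesis .
qed

text \<open>
  With \<open>n = \<lfloor>a * t\<rfloor>\<close> and \<open>a\<close> so small that \<open>(1 + K * H) ^ n \<le> exp (t / (4 * s))\<close>, half of the decay
  \<open>exp (- t / (2 * s))\<close> is left.
\<close>

lemma nn_integral_delay_linear:
  assumes d: "norm d = 1"
  obtains c :: real where "0 < c"
    "\<forall>\<^sub>F t in at_top. ennreal (c * t) \<le> (\<integral>\<^sup>+\<omega>. delay 0 (t *\<^sub>R d) \<omega> \<partial>M)"
proof -
  obtain H :: real where "0 \<le> H"
    and H: "\<And>y. (\<integral>\<^sup>+z. jump_bound y z * ennreal (exp (cell_dist y z)) \<partial>count_space UNIV) \<le> ennreal H"
    using jump_bound_summable by blast
  define K where "K = exp (4 * lam * s\<^sup>2)"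
  define L where "L = 1 + K * H"
  define \<delta> where "\<delta> = exp (- (2 * lam * measure lborel (ball (0 :: real^2) s)))"
  \<comment> \<open>The summand 1 keeps the denominator positive when \<open>L = 1\<close>.\<close>
  define a where "a = 1 / (4 * s * (ln L + 1))"
  have "1 \<le> L" using \<open>0 \<le> H\<close> by (simp add: L_def K_def)
  then have "0 \<le> ln L" by simp
  have "0 < \<delta>" by (simp add: \<delta>_def)
  have "0 < a" using s_pos \<open>0 \<le> ln L\<close> by (simp add: a_def)
  have "a * ln L \<le> 1 / (4 * s)"
    using s_pos \<open>0 \<le> ln L\<close> by (simp add: a_def divide_simps)
  have small: "4 * (exp (3 - t / (2 * s)) * (K * L ^ nat \<lfloor>a * t\<rfloor>)) \<le> 4 * K * exp 3 * exp (- (t / (4 * s)))"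
    if "0 \<le> t" for t
  proof -
    have "L ^ nat \<lfloor>a * t\<rfloor> = exp (real (nat \<lfloor>a * t\<rfloor>) * ln L)"
      using \<open>1 \<le> L\<close> by (simp add: exp_of_nat_mult)
    also have "real (nat \<lfloor>a * t\<rfloor>) * ln L \<le> (a * t) * ln L"
      using \<open>0 < a\<close> \<open>0 \<le> t\<close> \<open>0 \<le> ln L\<close> by (intro mult_right_mono) (auto simp: of_nat_nat)
    also have "\<dots> \<le> 1 / (4 * s) * t"
      using mult_right_mono[OF \<open>a * ln L \<le> 1 / (4 * s)\<close> that] by (simp add: ac_simps)
    finally have "L ^ nat \<lfloor>a * t\<rfloor> \<le> exp (t / (4 * s))" by simp
    then have "4 * (exp (3 - t / (2 * s)) * (K * L ^ nat \<lfloor>a * t\<rfloor>))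
        \<le> 4 * (exp (3 - t / (2 * s)) * (K * exp (t / (4 * s))))"
      by (intro mult_left_mono) (auto simp: K_def)
    also have "\<dots> = 4 * K * (exp (3 - t / (2 * s)) * exp (t / (4 * s)))" by simp
    also have "exp (3 - t / (2 * s)) * exp (t / (4 * s)) = exp 3 * exp (- (t / (4 * s)))"
      unfolding mult_exp_exp using s_pos by (simp add: field_simps)
    finally show ?thesis by (simp add: ac_simps)
  qed
  have "((\<lambda>t. 4 * K * exp 3 * exp (- (t / (4 * s)))) \<longlongrightarrow> 4 * K * exp 3 * 0) at_top"
    using s_pos by (intro tendsto_mult tendsto_const) real_asymp
  then have "\<forall>\<^sub>F t in at_top. 4 * K * exp 3 * exp (- (t / (4 * s))) < \<delta> / 2"
    using \<open>0 < \<delta>\<close> by (intro order_tendstoD(2)) auto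
  then have "\<forall>\<^sub>F t in at_top. ennreal ((a * \<delta> / 4) * t) \<le> (\<integral>\<^sup>+\<omega>. delay 0 (t *\<^sub>R d) \<omega> \<partial>M)"
    using eventually_ge_at_top[of "2 / a"] eventually_ge_at_top[of 0]
  proof eventually_elim
    case (elim t)
    let ?n = "nat \<lfloor>a * t\<rfloor>"
    have "1 \<le> a * t / 2" using elim(2) \<open>0 < a\<close> by (simp add: field_simps)
    then have "a * t / 2 \<le> real ?n" using elim(3) \<open>0 < a\<close> by linarith
    moreover have "\<delta> / 2 \<le> \<delta> - 4 * (exp (3 - t / (2 * s)) * (K * L ^ ?n))"
      using small[OF elim(3)] elim(1) by simp
    ultimately have "(a * t / 2) * (\<delta> / 2) \<le> real ?n * (\<delta> - 4 * (exp (3 - t / (2 * s)) * (K * L ^ ?n)))"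
      using \<open>0 < \<delta>\<close> by (intro mult_mono) auto
    then have "ennreal ((a * \<delta> / 4) * t) \<le> ennreal (real ?n * (\<delta> - 4 * (exp (3 - t / (2 * s)) * (K * L ^ ?n))))"
      by (intro ennreal_leI) (simp add: field_simps)
    also have "\<dots> \<le> (\<integral>\<^sup>+\<omega>. delay 0 (t *\<^sub>R d) \<omega> \<partial>M)"
      using nn_integral_delay_ge[OF d elim(3) H \<open>0 \<le> H\<close>] unfolding K_def L_def \<delta>_def .
    finally show ?case .
  qed
  moreover have "0 < a * \<delta> / 4" using \<open>0 < a\<close> \<open>0 < \<delta>\<close> by simp
  ultimately show thesis by (rule that[rotated])
qed

lemma nn_integral_mean_delay:
  assumes "mean_delay M (power_path_loss A \<beta>) T X e W F p"
  shows "p x y \<in> borel_measurable M" and "(\<integral>\<^sup>+\<omega>. p x y \<omega> \<partial>M) = (\<integral>\<^sup>+\<omega>. delay x y \<omega> \<partial>M)"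
proof -
  let ?G = "pp_sigma M X"
  let ?S = "{(\<lambda>\<omega>. pt_count (\<lambda>i. X i \<omega>) B) -` C \<inter> space M | B C. B \<in> sets borel \<and> C \<in> sets borel}"
  have S: "?S \<subseteq> sets M"
  proof safe
    fix B :: "(real^2) set" and C :: "ennreal set"
    assume "B \<in> sets borel" "C \<in> sets borel"
    then show "(\<lambda>\<omega>. pt_count (\<lambda>i. X i \<omega>) B) -` C \<inter> space M \<in> sets M"
      by (intro measurable_sets[OF pt_count_measurable]) auto
  qed
  then have S': "?S \<subseteq> Pow (space M)" using sets.space_closed by blast
  have sub: "subalgebra M ?G"
    unfolding subalgebra_def pp_sigma_def space_measure_of[OF S'] sets_measure_of[OF S']
    using sets.sigma_sets_subset[OF S] by simp
  interpret finite_measure_subalgebra M ?G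
    by unfold_locales (rule sub)
  have p: "p x y \<in> borel_measurable ?G" "AE \<omega> in M. p x y \<omega> = nn_cond_exp M ?G (delay x y) \<omega>"
    using assms unfolding mean_delay_def cond_exp_version_def by blast+
  show "p x y \<in> borel_measurable M"
    by (rule measurable_from_subalg[OF sub p(1)])
  have "(\<integral>\<^sup>+\<omega>. p x y \<omega> \<partial>M) = (\<integral>\<^sup>+\<omega>. 1 * nn_cond_exp M ?G (delay x y) \<omega> \<partial>M)"
    using p(2) by (intro nn_integral_cong_AE) auto
  also have "\<dots> = (\<integral>\<^sup>+\<omega>. 1 * delay x y \<omega> \<partial>M)"
    by (rule nn_cond_exp_intg) auto
  finally show "(\<integral>\<^sup>+\<omega>. p x y \<omega> \<partial>M) = (\<integral>\<^sup>+\<omega>. delay x y \<omega> \<partial>M)" by simp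
qed

end

section \<open>Positivity of the limit\<close>

text \<open>
  The inequality \<open>a / t - k \<le> \<bar>a / t - k\<bar>\<close> with \<open>k\<close> split into its positive and negative part, which
  makes it meaningful for infinite \<open>a\<close>.
\<close>

lemma ennreal_add_parts_le:
  fixes a :: ennreal and t k :: real
  assumes "0 < t"
  shows "a * ennreal (1 / t) + ennreal (- k) \<le> e2ennreal \<bar>enn2ereal a / ereal t - ereal k\<bar> + ennreal k"
proof (cases a)
  case (real r)
  have "a * ennreal (1 / t) + ennreal (- k) = ennreal (r / t + max 0 (- k))"
    using real assms by (simp add: ennreal_mult[symmetric] ennreal_max_0' max.commute)
  also have "\<dots> \<le> ennreal (\<bar>r / t - k\<bar> + max 0 k)"
    by (intro ennreal_leI) linarith
  also have "\<dots> = e2ennreal \<bar>enn2ereal a / ereal t - ereal k\<bar> + ennreal k"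
    using real assms by (simp add: enn2ereal_ennreal e2ennreal_ereal ennreal_max_0')
  finally show ?thesis .
next
  case top
  then show ?thesis using assms by (simp add: ennreal_top_mult)
qed

text \<open>
  A single large \<open>t\<close> is enough: the \<open>L\<^sub>1\<close> distance is below \<open>c / 2\<close> there, while the mean of
  \<open>f t / t\<close> is at least \<open>c\<close>.
\<close>

lemma expectation_pos_of_L1_limit:
  fixes f :: "real \<Rightarrow> 'b \<Rightarrow> ennreal"
  assumes "integrable N \<kappa>" and [measurable]: "\<And>t. f t \<in> borel_measurable N"
    and L1: "((\<lambda>t. \<integral>\<^sup>+\<omega>. e2ennreal \<bar>enn2ereal (f t \<omega>) / ereal t - ereal (\<kappa> \<omega>)\<bar> \<partial>N) \<longlongrightarrow> 0) at_top"
    and "0 < c" and lower: "\<forall>\<^sub>F t in at_top. ennreal (c * t) \<le> (\<integral>\<^sup>+\<omega>. f t \<omega> \<partial>N)"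
  shows "0 < (\<integral>\<omega>. \<kappa> \<omega> \<partial>N)"
proof -
  have [measurable]: "\<kappa> \<in> borel_measurable N" using assms(1) by simp
  have "\<forall>\<^sub>F t in at_top. (\<integral>\<^sup>+\<omega>. e2ennreal \<bar>enn2ereal (f t \<omega>) / ereal t - ereal (\<kappa> \<omega>)\<bar> \<partial>N) < ennreal (c / 2)"
    using L1 \<open>0 < c\<close> by (intro order_tendstoD(2)) auto
  with lower eventually_gt_at_top[of 0]
  have "\<forall>\<^sub>F t in at_top. 0 < t \<and> ennreal (c * t) \<le> (\<integral>\<^sup>+\<omega>. f t \<omega> \<partial>N) \<and>
      (\<integral>\<^sup>+\<omega>. e2ennreal \<bar>enn2ereal (f t \<omega>) / ereal t - ereal (\<kappa> \<omega>)\<bar> \<partial>N) < ennreal (c / 2)"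
    by (intro eventually_conj)
  from eventually_happens'[OF trivial_limit_at_top_linorder this]
  obtain t where t: "0 < t" "ennreal (c * t) \<le> (\<integral>\<^sup>+\<omega>. f t \<omega> \<partial>N)"
    "(\<integral>\<^sup>+\<omega>. e2ennreal \<bar>enn2ereal (f t \<omega>) / ereal t - ereal (\<kappa> \<omega>)\<bar> \<partial>N) < ennreal (c / 2)"
    by blast
  have "ennreal c + (\<integral>\<^sup>+\<omega>. ennreal (- \<kappa> \<omega>) \<partial>N)
      \<le> (\<integral>\<^sup>+\<omega>. f t \<omega> * ennreal (1 / t) \<partial>N) + (\<integral>\<^sup>+\<omega>. ennreal (- \<kappa> \<omega>) \<partial>N)"
  proof (intro add_right_mono)
    have "ennreal c = ennreal (c * t) * ennreal (1 / t)"
      using t(1) \<open>0 < c\<close> by (simp add: ennreal_mult[symmetric])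
    also have "\<dots> \<le> (\<integral>\<^sup>+\<omega>. f t \<omega> \<partial>N) * ennreal (1 / t)"
      by (intro mult_right_mono t(2)) simp
    also have "\<dots> = (\<integral>\<^sup>+\<omega>. f t \<omega> * ennreal (1 / t) \<partial>N)"
      by (simp add: nn_integral_multc)
    finally show "ennreal c \<le> (\<integral>\<^sup>+\<omega>. f t \<omega> * ennreal (1 / t) \<partial>N)" .
  qed
  also have "\<dots> = (\<integral>\<^sup>+\<omega>. f t \<omega> * ennreal (1 / t) + ennreal (- \<kappa> \<omega>) \<partial>N)"
    by (rule nn_integral_add[symmetric]) auto
  also have "\<dots> \<le> (\<integral>\<^sup>+\<omega>. e2ennreal \<bar>enn2ereal (f t \<omega>) / ereal t - ereal (\<kappa> \<omega>)\<bar> + ennreal (\<kappa> \<omega>) \<partial>N)"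
    by (intro nn_integral_mono ennreal_add_parts_le t(1))
  also have "\<dots> = (\<integral>\<^sup>+\<omega>. e2ennreal \<bar>enn2ereal (f t \<omega>) / ereal t - ereal (\<kappa> \<omega>)\<bar> \<partial>N) + (\<integral>\<^sup>+\<omega>. ennreal (\<kappa> \<omega>) \<partial>N)"
    by (rule nn_integral_add) auto
  also have "\<dots> \<le> ennreal (c / 2) + (\<integral>\<^sup>+\<omega>. ennreal (\<kappa> \<omega>) \<partial>N)"
    using t(3) by (intro add_right_mono) simp
  finally have le: "ennreal c + (\<integral>\<^sup>+\<omega>. ennreal (- \<kappa> \<omega>) \<partial>N) \<le> ennreal (c / 2) + (\<integral>\<^sup>+\<omega>. ennreal (\<kappa> \<omega>) \<partial>N)" .
  have fin: "(\<integral>\<^sup>+\<omega>. ennreal (\<kappa> \<omega>) \<partial>N) < top" "(\<integral>\<^sup>+\<omega>. ennreal (- \<kappa> \<omega>) \<partial>N) < top"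
    using assms(1) unfolding real_integrable_def by (auto simp: less_top)
  then obtain P Q where P: "0 \<le> P" "(\<integral>\<^sup>+\<omega>. ennreal (\<kappa> \<omega>) \<partial>N) = ennreal P"
    and Q: "0 \<le> Q" "(\<integral>\<^sup>+\<omega>. ennreal (- \<kappa> \<omega>) \<partial>N) = ennreal Q"
    by (metis less_top_ennreal)
  have "c + Q \<le> c / 2 + P"
    using le P Q \<open>0 < c\<close> by (simp add: ennreal_plus[symmetric] del: ennreal_plus)
  moreover have "(\<integral>\<omega>. \<kappa> \<omega> \<partial>N) = P - Q"
    using assms(1) P Q by (simp add: real_lebesgue_integral_def)
  ultimately show ?thesis using \<open>0 < c\<close> by simp
qed

theorem proposition3p6:
  fixes M :: "'w measure"
    and lam s q \<mu> w0 A \<beta> T :: real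
    and XM :: "nat \<Rightarrow> 'w \<Rightarrow> real^2"
    and U :: "'w \<Rightarrow> real^2"
    and e :: "pidx \<Rightarrow> int \<Rightarrow> 'w \<Rightarrow> bool"
    and W :: "pidx \<Rightarrow> int \<Rightarrow> 'w \<Rightarrow> real"
    and F :: "pidx \<Rightarrow> pidx \<Rightarrow> int \<Rightarrow> 'w \<Rightarrow> real"
    and p :: "real^2 \<Rightarrow> real^2 \<Rightarrow> 'w \<Rightarrow> ennreal"
    and d :: "real^2"
    and \<kappa> :: "'w \<Rightarrow> real"
  assumes model: "poisson_grid_model M lam s q LW LF XM U e W F"
    and fading_exponential: "0 < \<mu>" "LF = density lborel (exponential_density \<mu>)"
    and noise_constant: "0 < w0" "LW = return borel w0"
    and path_loss: "0 < A" "2 < \<beta>"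
    and threshold: "0 < T"
    and mean_delay: "mean_delay M (power_path_loss A \<beta>) T (poisson_grid s XM U) e W F p"
    and unit: "norm d = 1"
    and kappa: "time_constant M p d \<kappa>"
  shows "0 < prob_space.expectation M \<kappa>"
proof -
  interpret poisson_grid_model M lam s q LW LF XM U e W F by (rule model)
  interpret rayleigh_model M lam s q LW LF XM U e W F \<mu> w0 A \<beta> T
    by unfold_locales (use fading_exponential noise_constant path_loss threshold in auto)
  obtain c where "0 < c"
    and c: "\<forall>\<^sub>F t in at_top. ennreal (c * t) \<le> (\<integral>\<^sup>+\<omega>. delay 0 (t *\<^sub>R d) \<omega> \<partial>M)"
    using nn_integral_delay_linear[OF unit] by blast
  show ?thesis
  proof (rule expectation_pos_of_L1_limit[where f = "\<lambda>t. p 0 (t *\<^sub>R d)"])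
    show "\<forall>\<^sub>F t in at_top. ennreal (c * t) \<le> (\<integral>\<^sup>+\<omega>. p 0 (t *\<^sub>R d) \<omega> \<partial>M)"
      using c by (simp add: nn_integral_mean_delay(2)[OF mean_delay])
  qed (use kappa \<open>0 < c\<close> nn_integral_mean_delay(1)[OF mean_delay] in \<open>auto simp: time_constant_def\<close>)
qed

end
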